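(* There is an absolute constant $c$ such that for all natural numbers $m\ge 1$ and $n$, and every binary string $x_0$ with $\mathrm{C}(x_0)> n(m^2+m+1)+c(1+\log_2 m)$, there exist binary strings $x_1,\ldots,x_m$ such that $n\le \mathrm{C}(x_i|x_j)\le n+c(1+\log_2 m)$ for all distinct $i,j\in\{0,1,\ldots,m\}$.
   Context: $\mathrm{C}(x)$ and $\mathrm{C}(x|y)$ denote plain (unconditional and conditional) Kolmogorov complexity with respect to a fixed optimal programming language. *)

theory Defs
  imports Complex_Main "HOL-Library.Extended_Real"
begin

text \<open>
  Kleene's partial recursive functions. Arguments are passed as lists; a term applied to a list
  that is too short for it has no value.
\<close>

datatype recf =
    Zero
  | Succ
  | Proj nat
  | Comp recf "recf list"
  | PrimRec recf recf
  | Mu recf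

inductive recf_eval :: "recf \<Rightarrow> nat list \<Rightarrow> nat \<Rightarrow> bool" where
  Zero: "recf_eval Zero xs 0"
| Succ: "recf_eval Succ (x # xs) (Suc x)"
| Proj: "i < length xs \<Longrightarrow> recf_eval (Proj i) xs (xs ! i)"
| Comp: "length ys = length gs \<Longrightarrow> (\<forall>i < length gs. recf_eval (gs ! i) xs (ys ! i)) \<Longrightarrow>
    recf_eval f ys z \<Longrightarrow> recf_eval (Comp f gs) xs z"
| PrimRec_0: "recf_eval f xs z \<Longrightarrow> recf_eval (PrimRec f g) (0 # xs) z"
| PrimRec_Suc: "recf_eval (PrimRec f g) (k # xs) y \<Longrightarrow> recf_eval g (k # y # xs) z \<Longrightarrow>
    recf_eval (PrimRec f g) (Suc k # xs) z"
| Mu: "recf_eval f (k # xs) 0 \<Longrightarrow> (\<forall>j < k. \<exists>y. recf_eval f (j # xs) (Suc y)) \<Longrightarrow>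
    recf_eval (Mu f) xs k"

text \<open>
  Binary strings are identified with natural numbers by bijective base-2 numeration.
\<close>

fun string_code :: "bool list \<Rightarrow> nat" where
  "string_code [] = 0"
| "string_code (b # bs) = 2 * string_code bs + (if b then 2 else 1)"

lemma inj_string_code: "inj string_code"
proof (rule injI)
  fix xs ys
  show "string_code xs = string_code ys \<Longrightarrow> xs = ys"
  proof (induction xs arbitrary: ys)
    case Nil
    then show ?case by (cases ys) (auto split: if_splits)
  next
    case (Cons a xs)
    then obtain b zs where ys: "ys = b # zs" by (cases ys) (auto split: if_splits)
    with Cons.prems have "a = b \<and> string_code xs = string_code zs"
      by (auto split: if_splits) presburger+
    with Cons.IH ys show ?case by blast
  qed
qed

lemma surj_string_code: "surj string_code"
proof -
  have "\<exists>xs. n = string_code xs" for n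
  proof (induction n rule: less_induct)
    case (less n)
    show ?case
    proof (cases "n = 0")
      case True
      then show ?thesis by (intro exI[of _ "[]"]) simp
    next
      case False
      then have "(n - 1) div 2 < n" by auto
      from less[OF this] obtain xs where "(n - 1) div 2 = string_code xs" by blast
      moreover have "n = 2 * ((n - 1) div 2) + (if even n then 2 else 1)"
        using False by presburger
      ultimately show ?thesis by (intro exI[of _ "even n # xs"]) simp
    qed
  qed
  then show ?thesis by (simp add: surj_def)
qed

lemma bij_string_code: "bij string_code"
  by (simp add: bij_def inj_string_code surj_string_code)

text \<open>
  A programming language is a partial computable function of a program and an input string.
\<close>

definition programming_language ::
  "(bool list \<Rightarrow> bool list \<Rightarrow> bool list option) \<Rightarrow> bool" where
  "programming_language V \<longleftrightarrow>
    (\<exists>f. \<forall>p y x. V p y = Some x \<longleftrightarrow>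
      recf_eval f [string_code p, string_code y] (string_code x))"

text \<open>
  The plain complexity of \<open>x\<close> conditional to \<open>y\<close>; it is \<open>\<infinity>\<close> if no program maps \<open>y\<close> to \<open>x\<close>.
\<close>

definition cond_complexity ::
  "(bool list \<Rightarrow> bool list \<Rightarrow> bool list option) \<Rightarrow> bool list \<Rightarrow> bool list \<Rightarrow> enat" where
  "cond_complexity V x y = (INF p \<in> {p. V p y = Some x}. enat (length p))"

definition complexity ::
  "(bool list \<Rightarrow> bool list \<Rightarrow> bool list option) \<Rightarrow> bool list \<Rightarrow> enat" where
  "complexity V x = cond_complexity V x []"

definition optimal_language ::
  "(bool list \<Rightarrow> bool list \<Rightarrow> bool list option) \<Rightarrow> bool" where
  "optimal_language U \<longleftrightarrow> programming_language U \<and>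
    (\<forall>V. programming_language V \<longrightarrow>
      (\<exists>c::nat. \<forall>x y. cond_complexity U x y \<le> cond_complexity V x y + enat c))"

end

theory Submission
  imports Defs "HOL-Library.Nat_Bijection" "HOL-Library.More_List" "HOL-Library.FuncSet"
begin

text \<open>
  For fixed \<open>m\<close> and \<open>n\<close> play the following game while enumerating the pairs \<open>(a, b)\<close> with
  \<open>C(a|b) < n\<close>. Every string occurs once in each of the roles \<open>0, \<dots>, m\<close>; initially string \<open>s\<close>
  forms the tuple \<open>(s, \<dots>, s)\<close>. A tuple \<open>x\<close> breaks with cause \<open>(i, j)\<close> when \<open>C(x\<^sub>i|x\<^sub>j) < n\<close> is
  discovered. The level of a string in a role counts, for each cause, the broken tuples that
  contained it, and all members of a tuple have the same level. After a break the members become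
  free, and the string in role \<open>0\<close> is regrouped greedily with free strings of its new level, no two
  members of the new tuple having been together before; if this is impossible, it stays single
  forever.

  A string in role \<open>j\<close> suffers fewer than \<open>2\<^sup>n\<close> breaks with cause \<open>(i, j)\<close>, since these come with
  different strings \<open>x\<^sub>i\<close>. As levels agree inside tuples, and each level has equally many free
  strings in all roles, every count of every level is below \<open>2\<^sup>n\<close>. Hence a string meets only
  \<open>2\<^sup>n poly(m)\<close> partners, the greedy choice fails at a level only while that level has at most
  \<open>2\<^sup>n poly(m)\<close> free strings, and at most \<open>2^(n(m^2 + m + 1)) poly(m)\<close> strings stay single. These
  enumerations bound the complexity of single strings and the conditional complexities inside
  tuples, while a tuple that never breaks satisfies \<open>C(x\<^sub>i|x\<^sub>j) \<ge> n\<close>.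
\<close>

section \<open>Recursive functions\<close>

inductive_cases recf_eval_ZeroE: "recf_eval Zero xs z"
inductive_cases recf_eval_SuccE: "recf_eval Succ xs z"
inductive_cases recf_eval_ProjE: "recf_eval (Proj i) xs z"
inductive_cases recf_eval_CompE: "recf_eval (Comp f gs) xs z"
inductive_cases recf_eval_PrimRecE: "recf_eval (PrimRec f g) xs z"
inductive_cases recf_eval_PrimRec_0E: "recf_eval (PrimRec f g) (0 # xs) z"
inductive_cases recf_eval_PrimRec_SucE: "recf_eval (PrimRec f g) (Suc k # xs) z"
inductive_cases recf_eval_MuE: "recf_eval (Mu f) xs z"

lemma recf_eval_functional:
  assumes "recf_eval f xs y" "recf_eval f xs z"
  shows "y = z"
  using assms
proof (induction arbitrary: z rule: recf_eval.induct)
  case (Zero xs)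
  then show ?case by (auto elim: recf_eval_ZeroE)
next
  case (Succ x xs)
  then show ?case by (auto elim: recf_eval_SuccE)
next
  case (Proj i xs)
  then show ?case by (auto elim: recf_eval_ProjE)
next
  case (Comp ys gs xs f z z')
  from Comp.prems obtain ys' where ys': "length ys' = length gs"
    "\<forall>i<length gs. recf_eval (gs ! i) xs (ys' ! i)" "recf_eval f ys' z'"
    by (auto elim: recf_eval_CompE)
  have "ys = ys'"
    using Comp.hyps Comp.IH(1) ys'(1,2) by (auto intro: nth_equalityI)
  then show ?case using Comp.IH(2) ys'(3) by blast
next
  case (PrimRec_0 f xs z g)
  from PrimRec_0.prems show ?case by (rule recf_eval_PrimRec_0E) (rule PrimRec_0.IH)
next
  case (PrimRec_Suc f g k xs y z)
  from PrimRec_Suc.prems show ?case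
    by (rule recf_eval_PrimRec_SucE) (use PrimRec_Suc.IH in blast)
next
  case (Mu f k xs k')
  from Mu.prems have k': "recf_eval f (k' # xs) 0" "\<forall>j<k'. \<exists>y. recf_eval f (j # xs) (Suc y)"
    by (auto elim: recf_eval_MuE)
  show ?case
  proof (rule linorder_cases[of k k'])
    assume "k < k'"
    then obtain y where "recf_eval f (k # xs) (Suc y)" using k'(2) by blast
    with Mu.IH(1) show ?thesis by blast
  next
    assume "k' < k"
    then obtain y where "\<forall>z. recf_eval f (k' # xs) z \<longrightarrow> Suc y = z" using Mu.IH(2) by blast
    with k'(1) show ?thesis by blast
  qed
qed

lemma recf_eval_Comp1:
  "recf_eval g xs y \<Longrightarrow> recf_eval f [y] z \<Longrightarrow> recf_eval (Comp f [g]) xs z"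
  by (rule recf_eval.Comp[of "[y]"]) auto

lemma recf_eval_Comp2:
  "recf_eval g xs y \<Longrightarrow> recf_eval h xs y' \<Longrightarrow> recf_eval f [y, y'] z \<Longrightarrow> recf_eval (Comp f [g, h]) xs z"
  by (rule recf_eval.Comp[of "[y, y']"]) (auto simp: less_Suc_eq)

lemma recf_eval_Proj_0: "recf_eval (Proj 0) (x # xs) x"
  and recf_eval_Proj_1: "recf_eval (Proj (Suc 0)) (x # y # xs) y"
  and recf_eval_Proj_2: "recf_eval (Proj 2) (x # y # z # xs) z"
  using recf_eval.Proj[of 0 "x # xs"] recf_eval.Proj[of 1 "x # y # xs"]
    recf_eval.Proj[of 2 "x # y # z # xs"] by auto

lemmas recf_eval_intros = recf_eval_Proj_0 recf_eval_Proj_1 recf_eval_Proj_2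
  recf_eval.Zero recf_eval.Succ recf_eval_Comp1 recf_eval_Comp2

section \<open>Arithmetic, Cantor pairing and its projections as terms\<close>

definition recf_add :: recf where
  "recf_add = PrimRec (Proj 0) (Comp Succ [Proj (Suc 0)])"

definition recf_pred :: recf where
  "recf_pred = PrimRec Zero (Proj 0)"

text \<open>Recursion runs on the first argument, so the subtrahend comes first.\<close>

definition recf_sub :: recf where
  "recf_sub = PrimRec (Proj 0) (Comp recf_pred [Proj (Suc 0)])"

definition recf_triangle :: recf where
  "recf_triangle = PrimRec Zero (Comp recf_add [Comp Succ [Proj 0], Proj (Suc 0)])"

definition recf_pair :: recf where
  "recf_pair = Comp recf_add [Comp recf_triangle [recf_add], Proj 0]"

lemma recf_eval_PrimRec_rec_nat:
  assumes "recf_eval f xs a"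
    and "\<And>k r. recf_eval g (k # r # xs) (b k r)"
  shows "recf_eval (PrimRec f g) (k # xs) (rec_nat a b k)"
  by (induction k) (auto intro: recf_eval.PrimRec_0 recf_eval.PrimRec_Suc assms)

lemma recf_eval_add: "recf_eval recf_add (x # y # ys) (x + y)"
proof -
  have "recf_eval recf_add (x # y # ys) (rec_nat y (\<lambda>_. Suc) x)"
    unfolding recf_add_def by (intro recf_eval_PrimRec_rec_nat) (auto intro!: recf_eval_intros)
  moreover have "rec_nat y (\<lambda>_. Suc) x = x + y" by (induction x) auto
  ultimately show ?thesis by simp
qed

lemma recf_eval_pred: "recf_eval recf_pred (x # xs) (x - 1)"
proof -
  have "recf_eval recf_pred (x # xs) (rec_nat 0 (\<lambda>k _. k) x)"
    unfolding recf_pred_def by (intro recf_eval_PrimRec_rec_nat) (auto intro!: recf_eval_intros)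
  then show ?thesis by (cases x) auto
qed

lemma recf_eval_sub: "recf_eval recf_sub (x # y # ys) (y - x)"
proof -
  have "recf_eval recf_sub (x # y # ys) (rec_nat y (\<lambda>_ r. r - 1) x)"
    unfolding recf_sub_def
    by (intro recf_eval_PrimRec_rec_nat) (auto intro!: recf_eval_intros recf_eval_pred[simplified])
  moreover have "rec_nat y (\<lambda>_ r. r - 1) x = y - x" by (induction x) auto
  ultimately show ?thesis by simp
qed

lemma recf_eval_triangle: "recf_eval recf_triangle (x # xs) (triangle x)"
proof -
  have "recf_eval recf_triangle (x # xs) (rec_nat 0 (\<lambda>k r. Suc k + r) x)"
    unfolding recf_triangle_def
    by (rule recf_eval_PrimRec_rec_nat) (rule recf_eval_intros recf_eval_add)+
  moreover have "rec_nat 0 (\<lambda>k r. Suc k + r) x = triangle x" by (induction x) auto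
  ultimately show ?thesis by simp
qed

lemma recf_eval_pair: "recf_eval recf_pair (x # y # ys) (prod_encode (x, y))"
  unfolding recf_pair_def prod_encode_def
  by (auto intro!: recf_eval_intros recf_eval_add recf_eval_triangle)

text \<open>\<open>Mu\<close> finds the diagonal on which a pair lies.\<close>

definition recf_diag :: recf where
  "recf_diag = Mu (Comp recf_sub [Comp recf_triangle [Comp Succ [Proj 0]], Comp Succ [Proj (Suc 0)]])"

text \<open>The code \<open>z\<close> of \<open>(x, y)\<close> satisfies
  \<open>triangle (x + y) <= z < triangle (x + y + 1)\<close>, so \<open>x + y\<close> is the least
  \<open>k\<close> at which the truncated difference \<open>Suc z - triangle (Suc k)\<close>
  vanishes.\<close>

lemma recf_eval_diag: "recf_eval recf_diag (prod_encode (x, y) # xs) (x + y)"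
proof -
  let ?z = "prod_encode (x, y)"
  let ?f = "Comp recf_sub [Comp recf_triangle [Comp Succ [Proj 0]], Comp Succ [Proj (Suc 0)]]"
  have f: "recf_eval ?f (k # ?z # xs) (Suc ?z - triangle (Suc k))" for k
    by (auto intro!: recf_eval_intros recf_eval_triangle recf_eval_sub simp del: triangle_Suc)
  have z: "?z = triangle (x + y) + x" by (simp add: prod_encode_def)
  have mono: "triangle a \<le> triangle b" if "a \<le> b" for a b
    using that by (induction rule: dec_induct) auto
  have "Suc ?z - triangle (Suc (x + y)) = 0" by (simp add: z)
  moreover have "\<exists>v. Suc ?z - triangle (Suc j) = Suc v" if "j < x + y" for j
  proof -
    have "triangle (Suc j) \<le> triangle (x + y)" using that by (intro mono) simp
    then have "0 < Suc ?z - triangle (Suc j)" unfolding z by linarith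
    then show ?thesis using gr0_conv_Suc by blast
  qed
  ultimately show ?thesis
    unfolding recf_diag_def using f by (intro recf_eval.Mu) metis+
qed

definition recf_fst :: recf where
  "recf_fst = Comp recf_sub [Comp recf_triangle [recf_diag], Proj 0]"

definition recf_snd :: recf where
  "recf_snd = Comp recf_sub [recf_fst, recf_diag]"

lemma recf_eval_fst: "recf_eval recf_fst (prod_encode (x, y) # xs) x"
proof -
  have "recf_eval recf_fst (prod_encode (x, y) # xs) (prod_encode (x, y) - triangle (x + y))"
    unfolding recf_fst_def
    by (rule recf_eval_intros recf_eval_triangle recf_eval_sub recf_eval_diag)+
  then show ?thesis by (simp add: prod_encode_def)
qed

lemma recf_eval_snd: "recf_eval recf_snd (prod_encode (x, y) # xs) y"
proof -
  have "recf_eval recf_snd (prod_encode (x, y) # xs) (x + y - x)"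
    unfolding recf_snd_def
    by (rule recf_eval_intros recf_eval_fst recf_eval_sub recf_eval_diag)+
  then show ?thesis by simp
qed


section \<open>Computable functions on coded types\<close>

text \<open>Codes are bijective, so that every number is the code of a witness and no total function
  is ever applied to a number that codes nothing.\<close>

class coded =
  fixes enc :: "'a \<Rightarrow> nat"
  assumes bij_enc: "bij enc"
begin

lemma enc_eq_iff [simp]: "enc x = enc y \<longleftrightarrow> x = y"
  using bij_enc by (auto simp: bij_def inj_def)

lemma enc_inv [simp]: "enc (inv enc k) = k"
  using bij_enc by (simp add: bij_def surj_f_inv_f)

end

instantiation nat :: coded
begin
definition "enc (n::nat) = n"
instance by standard (simp add: enc_nat_def bij_def inj_def)
end

instantiation prod :: (coded, coded) coded
begin
definition "enc p = prod_encode (enc (fst p), enc (snd p))"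
instance
proof
  have "surj (enc :: 'a \<times> 'b \<Rightarrow> nat)"
  proof (rule surjI)
    fix k
    show "enc ((inv enc (fst (prod_decode k)), inv enc (snd (prod_decode k))) :: 'a \<times> 'b) = k"
      by (simp add: enc_prod_def)
  qed
  then show "bij (enc :: 'a \<times> 'b \<Rightarrow> nat)"
    by (auto simp: bij_def inj_def enc_prod_def prod_eq_iff)
qed
end

instantiation list :: (coded) coded
begin
primrec enc_list :: "'a list \<Rightarrow> nat" where
  "enc_list [] = 0"
| "enc_list (x # xs) = Suc (prod_encode (enc x, enc_list xs))"
instance
proof
  have "xs = ys" if "enc xs = enc ys" for xs ys :: "'a list"
    using that
  proof (induction xs arbitrary: ys)
    case Nil
    then show ?case by (cases ys) auto
  next
    case (Cons x xs)
    then show ?case by (cases ys) auto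
  qed
  moreover have "\<exists>xs :: 'a list. enc xs = k" for k
  proof (induction k rule: less_induct)
    case (less k)
    show ?case
    proof (cases k)
      case 0
      then show ?thesis by (intro exI[of _ "[]"]) simp
    next
      case (Suc k')
      obtain a b where ab: "k' = prod_encode (a, b)" by (metis prod_decode_inverse surj_pair)
      then have "b < k" using le_prod_encode_2[of b a] Suc by simp
      from less[OF this] obtain xs :: "'a list" where "enc xs = b" by blast
      then show ?thesis using Suc ab by (intro exI[of _ "inv enc a # xs"]) simp
    qed
  qed
  ultimately show "bij (enc :: 'a list \<Rightarrow> nat)"
    by (metis bij_def injI surj_def)
qed
end

section \<open>Total computable functions: composition, arithmetic, decisions\<close>

definition computable :: "('a::coded \<Rightarrow> 'b::coded) \<Rightarrow> bool" where
  "computable f \<longleftrightarrow> (\<exists>g. \<forall>x. recf_eval g [enc x] (enc (f x)))"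

definition decidable :: "('a::coded \<Rightarrow> bool) \<Rightarrow> bool" where
  "decidable P \<longleftrightarrow> computable (\<lambda>x. of_bool (P x) :: nat)"

named_theorems computable_intros

lemma computable_ident [computable_intros]: "computable (\<lambda>x. x)"
  unfolding computable_def by (auto intro: recf_eval_Proj_0)

lemma computable_compose:
  assumes "computable f" "computable g"
  shows "computable (\<lambda>x. f (g x))"
  using assms unfolding computable_def by (meson recf_eval_Comp1)

lemma computable_compose2:
  assumes "computable (\<lambda>p. f (fst p) (snd p))" "computable g" "computable h"
  shows "computable (\<lambda>x. f (g x) (h x))"
proof -
  obtain F G H where F: "\<And>p. recf_eval F [enc p] (enc (f (fst p) (snd p)))"
    and G: "\<And>x. recf_eval G [enc x] (enc (g x))" and H: "\<And>x. recf_eval H [enc x] (enc (h x))"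
    using assms unfolding computable_def by blast
  have "recf_eval (Comp F [Comp recf_pair [G, H]]) [enc x] (enc (f (g x) (h x)))" for x
    using F[of "(g x, h x)"]
    by (auto intro!: recf_eval_intros G H recf_eval_pair simp: enc_prod_def)
  then show ?thesis unfolding computable_def by blast
qed

lemma computable_Pair [computable_intros]:
  "computable f \<Longrightarrow> computable g \<Longrightarrow> computable (\<lambda>x. (f x, g x))"
  using computable_compose2[of Pair f g] computable_ident by simp

lemma computable_fst [computable_intros]: "computable f \<Longrightarrow> computable (\<lambda>x. fst (f x))"
proof (rule computable_compose[of fst])
  show "computable (fst :: 'b \<times> 'c \<Rightarrow> 'b)"
    unfolding computable_def enc_prod_def using recf_eval_fst by blast
qed

lemma computable_snd [computable_intros]: "computable f \<Longrightarrow> computable (\<lambda>x. snd (f x))"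
proof (rule computable_compose[of snd])
  show "computable (snd :: 'b \<times> 'c \<Rightarrow> 'c)"
    unfolding computable_def enc_prod_def using recf_eval_snd by blast
qed

lemma computable_const [computable_intros]: "computable (\<lambda>x. c)"
proof -
  have "\<exists>g. \<forall>xs. recf_eval g xs k" for k
  proof (induction k)
    case 0
    then show ?case by (auto intro: recf_eval.Zero)
  next
    case (Suc k)
    then show ?case by (meson recf_eval_Comp1 recf_eval.Succ)
  qed
  then show ?thesis unfolding computable_def by blast
qed

lemma computable_enc: "computable f \<Longrightarrow> computable (\<lambda>x. enc (f x))"
  unfolding computable_def by (simp add: enc_nat_def)

lemma computable_prod_decode [computable_intros]:
  "computable f \<Longrightarrow> computable (\<lambda>x. prod_decode (f x))"
  unfolding computable_def by (simp add: enc_nat_def enc_prod_def)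

lemma computable_Suc [computable_intros]: "computable f \<Longrightarrow> computable (\<lambda>x. Suc (f x))"
proof (rule computable_compose[of Suc])
  show "computable Suc"
    unfolding computable_def enc_nat_def using recf_eval.Succ by blast
qed

lemma computable_rec_nat [computable_intros]:
  fixes a :: "'a::coded \<Rightarrow> 'b::coded"
  assumes a: "computable a"
    and b: "computable (\<lambda>p. b (fst p) (fst (snd p)) (snd (snd p)))"
    and n: "computable n"
  shows "computable (\<lambda>e. rec_nat (a e) (\<lambda>k r. b e k r) (n e))"
proof (rule computable_compose2[OF _ computable_ident n])
  obtain A B where A: "\<And>e. recf_eval A [enc e] (enc (a e))"
    and B: "\<And>e k r. recf_eval B [enc (e, k, r)] (enc (b e k r))"
    using a b unfolding computable_def by (metis fst_conv snd_conv)
  \<comment> \<open>\<open>PrimRec\<close> passes counter, previous value and parameter in this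
    order; they are rearranged into the code of \<open>(e, k, r)\<close>.\<close>
  let ?B = "Comp B [Comp recf_pair [Proj 2, Comp recf_pair [Proj 0, Proj (Suc 0)]]]"
  have B': "recf_eval ?B [k, enc r, enc e] (enc (b e k r))" for e k r
    using B[of e k r] unfolding enc_prod_def fst_conv snd_conv enc_nat_def
    by (auto intro!: recf_eval_intros recf_eval_pair)
  have main: "recf_eval (PrimRec A ?B) [k, enc e] (enc (rec_nat (a e) (b e) k))" for k e
  proof (induction k)
    case 0
    then show ?case using A by (auto intro: recf_eval.PrimRec_0)
  next
    case (Suc k)
    then show ?case using B' by (auto intro: recf_eval.PrimRec_Suc)
  qed
  have "recf_eval (Comp (PrimRec A ?B) [recf_snd, recf_fst]) [enc p]
      (enc (rec_nat (a (fst p)) (b (fst p)) (snd p)))" for p :: "'a \<times> nat"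
    unfolding enc_prod_def enc_nat_def
    by (rule recf_eval_Comp2 recf_eval_fst recf_eval_snd main)+
  then show "computable (\<lambda>p. rec_nat (a (fst p)) (\<lambda>k r. b (fst p) k r) (snd p))"
    unfolding computable_def by blast
qed

lemma computable_funpow [computable_intros]:
  fixes f :: "'a::coded \<Rightarrow> 'b::coded \<Rightarrow> 'b"
  assumes "computable (\<lambda>p. f (fst p) (snd p))" "computable n" "computable a"
  shows "computable (\<lambda>e. (f e ^^ n e) (a e))"
proof -
  have "(g ^^ k) c = rec_nat c (\<lambda>k r. g r) k" for g :: "'b \<Rightarrow> 'b" and k c
    by (induction k) auto
  moreover have "computable (\<lambda>p. f (fst p) (snd (snd p)))"
    by (rule computable_compose2[OF assms(1)]) (intro computable_intros)+
  ultimately show ?thesis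
    using computable_rec_nat[of a "\<lambda>e k r. f e r" n] assms by simp
qed

lemma computable_add [computable_intros]:
  "computable f \<Longrightarrow> computable g \<Longrightarrow> computable (\<lambda>x. f x + g x :: nat)"
proof (rule computable_compose2[of "(+)"])
  have "recf_eval (Comp recf_add [recf_fst, recf_snd]) [enc p] (enc (fst p + snd p))"
    for p :: "nat \<times> nat"
    unfolding enc_prod_def enc_nat_def
    by (rule recf_eval_intros recf_eval_fst recf_eval_snd recf_eval_add)+
  then show "computable (\<lambda>p. fst p + snd p :: nat)" unfolding computable_def by blast
qed

lemma computable_diff [computable_intros]:
  "computable f \<Longrightarrow> computable g \<Longrightarrow> computable (\<lambda>x. f x - g x :: nat)"
proof (rule computable_compose2[of "(-)"])
  have "recf_eval (Comp recf_sub [recf_snd, recf_fst]) [enc p] (enc (fst p - snd p))"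
    for p :: "nat \<times> nat"
    unfolding enc_prod_def enc_nat_def
    by (rule recf_eval_intros recf_eval_fst recf_eval_snd recf_eval_sub)+
  then show "computable (\<lambda>p. fst p - snd p :: nat)" unfolding computable_def by blast
qed

lemma computable_mult [computable_intros]:
  assumes "computable f" "computable g"
  shows "computable (\<lambda>x. f x * g x :: nat)"
proof -
  have "a * b = rec_nat 0 (\<lambda>_ r. r + b) a" for a b :: nat by (induction a) auto
  moreover have "computable (\<lambda>x. rec_nat 0 (\<lambda>_ r. r + g x) (f x))"
    by (intro computable_intros assms computable_compose[OF assms(2)])
  ultimately show ?thesis by simp
qed

lemma computable_power [computable_intros]:
  assumes "computable f" "computable g"
  shows "computable (\<lambda>x. f x ^ g x :: nat)"
proof -
  have "a ^ b = rec_nat 1 (\<lambda>_ r. a * r) b" for a b :: nat by (induction b) auto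
  moreover have "computable (\<lambda>x. rec_nat 1 (\<lambda>_ r. f x * r) (g x))"
    by (intro computable_intros assms computable_compose[OF assms(1)])
  ultimately show ?thesis by simp
qed

text \<open>The truth value serves as a recursion counter: zero rounds leave the else-value, one
  round replaces it.\<close>

lemma computable_if [computable_intros]:
  assumes "decidable c" "computable f" "computable g"
  shows "computable (\<lambda>x. if c x then f x else g x)"
proof -
  have "(if c x then f x else g x) = rec_nat (g x) (\<lambda>_ _. f x) (of_bool (c x))" for x by simp
  moreover have "computable (\<lambda>x. rec_nat (g x) (\<lambda>_ _. f x) (of_bool (c x)))"
    using assms(1) unfolding decidable_def
    by (intro computable_intros assms computable_compose[OF assms(2)])
  ultimately show ?thesis by simp
qed

lemma decidable_const [computable_intros]: "decidable (\<lambda>x. c)"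
  unfolding decidable_def by (rule computable_const)

lemma decidable_compose:
  assumes "decidable P" "computable f"
  shows "decidable (\<lambda>x. P (f x))"
  using assms computable_compose unfolding decidable_def by blast

lemma decidable_not [computable_intros]:
  assumes "decidable P"
  shows "decidable (\<lambda>x. \<not> P x)"
proof -
  have "(\<lambda>x. of_bool (\<not> P x) :: nat) = (\<lambda>x. 1 - of_bool (P x))" by auto
  then show ?thesis using assms unfolding decidable_def by (auto intro: computable_intros)
qed

lemma decidable_conj [computable_intros]:
  assumes "decidable P" "decidable Q"
  shows "decidable (\<lambda>x. P x \<and> Q x)"
proof -
  have "(\<lambda>x. of_bool (P x \<and> Q x) :: nat) = (\<lambda>x. of_bool (P x) * of_bool (Q x))" by auto
  then show ?thesis using assms unfolding decidable_def by (auto intro: computable_intros)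
qed

lemma decidable_disj [computable_intros]:
  "decidable P \<Longrightarrow> decidable Q \<Longrightarrow> decidable (\<lambda>x. P x \<or> Q x)"
  using decidable_not[OF decidable_conj[OF decidable_not decidable_not], of P Q] by simp

lemma decidable_imp [computable_intros]:
  "decidable P \<Longrightarrow> decidable Q \<Longrightarrow> decidable (\<lambda>x. P x \<longrightarrow> Q x)"
  unfolding imp_conv_disj by (intro computable_intros)

lemma decidable_le [computable_intros]:
  assumes "computable f" "computable g"
  shows "decidable (\<lambda>x. f x \<le> (g x :: nat))"
proof -
  have "(\<lambda>x. of_bool (f x \<le> g x) :: nat) = (\<lambda>x. 1 - (f x - g x))" by (auto simp: fun_eq_iff)
  then show ?thesis using assms unfolding decidable_def by (auto intro: computable_intros)
qed

lemma decidable_less [computable_intros]: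
  assumes "computable f" "computable g"
  shows "decidable (\<lambda>x. f x < (g x :: nat))"
  using decidable_not[OF decidable_le[OF assms(2,1)]] by (simp add: not_le)

lemma decidable_eq [computable_intros]:
  assumes "computable f" "computable g"
  shows "decidable (\<lambda>x. f x = g x)"
proof -
  have "decidable (\<lambda>x. enc (f x) \<le> enc (g x) \<and> enc (g x) \<le> enc (f x))"
    by (intro computable_intros computable_enc assms)
  then show ?thesis by (simp add: eq_iff[symmetric])
qed

section \<open>List operations\<close>

lemma computable_Cons [computable_intros]:
  assumes "computable f" "computable g"
  shows "computable (\<lambda>x. f x # g x)"
proof -
  have "computable (\<lambda>x. Suc (enc (f x, g x)))" by (intro computable_intros computable_enc assms)
  then show ?thesis unfolding computable_def by (simp add: enc_nat_def enc_prod_def)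
qed

text \<open>On the empty list the code of the pair of head and tail is read off the number \<open>0 - 1 = 0\<close>.\<close>

lemma computable_hd_tl:
  "computable (\<lambda>xs :: 'a::coded list. if xs = [] then inv enc 0 else (hd xs, tl xs))"
proof -
  have "enc (if xs = [] then inv enc 0 else (hd xs, tl xs)) = enc xs - 1" for xs :: "'a list"
    by (cases "xs = []") (simp, cases xs, auto simp: enc_prod_def)
  then show ?thesis unfolding computable_def using recf_eval_pred by metis
qed

text \<open>The value \<open>hd []\<close> is unspecified but fixed, hence a constant in the case
  distinction.\<close>

lemma computable_hd [computable_intros]:
  assumes "computable f"
  shows "computable (\<lambda>x. hd (f x))"
proof (rule computable_compose[OF _ assms])
  have "hd xs = (if xs = [] then hd [] else fst (if xs = [] then inv enc 0 else (hd xs, tl xs)))"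
    for xs :: "'b list" by simp
  moreover have "computable (\<lambda>xs :: 'b list. if xs = [] then hd []
      else fst (if xs = [] then inv enc 0 else (hd xs, tl xs)))"
    by (intro computable_if computable_fst computable_hd_tl computable_intros)
  ultimately show "computable (hd :: 'b list \<Rightarrow> 'b)" by presburger
qed

lemma computable_tl [computable_intros]:
  assumes "computable f"
  shows "computable (\<lambda>x. tl (f x))"
proof (rule computable_compose[OF _ assms])
  have "tl xs = (if xs = [] then [] else snd (if xs = [] then inv enc 0 else (hd xs, tl xs)))"
    for xs :: "'b list" by simp
  moreover have "computable (\<lambda>xs :: 'b list. if xs = [] then []
      else snd (if xs = [] then inv enc 0 else (hd xs, tl xs)))"
    by (intro computable_if computable_snd computable_hd_tl computable_intros)
  ultimately show "computable (tl :: 'b list \<Rightarrow> 'b list)" by presburger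
qed

text \<open>Supplies \<open>computable_fold\<close> with a number of rounds that suffices to
  traverse the list; \<open>length\<close> itself is shown computable only by means of
  \<open>fold\<close>.\<close>

lemma length_le_enc: "length xs \<le> enc xs"
proof (induction xs)
  case (Cons x xs)
  then show ?case using le_prod_encode_2[of "enc xs" "enc x"] by simp
qed simp

lemma computable_fold [computable_intros]:
  fixes f :: "'a::coded \<Rightarrow> 'b::coded \<Rightarrow> 'c::coded \<Rightarrow> 'c"
  assumes f: "computable (\<lambda>p. f (fst p) (fst (snd p)) (snd (snd p)))"
    and xs: "computable xs" and a: "computable a"
  shows "computable (\<lambda>e. fold (f e) (xs e) (a e))"
proof -
  \<comment> \<open>On an exhausted list \<open>step\<close> is the identity, so surplus rounds do
    no harm.\<close>
  define step where "step e q = (if fst q = [] then q else (tl (fst q), f e (hd (fst q)) (snd q)))"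
    for e and q :: "'b list \<times> 'c"
  have step: "(step e ^^ n) (l, c) = ([], fold (f e) l c)" if "length l \<le> n" for e n l c
    using that
  proof (induction n arbitrary: l c)
    case (Suc n)
    have "(step e ^^ Suc n) (l, c) = (step e ^^ n) (step e (l, c))"
      by (simp add: funpow_swap1)
    also have "\<dots> = ([], fold (f e) l c)"
    proof (cases l)
      case Nil
      then have "step e (l, c) = (l, c)" by (simp add: step_def)
      then show ?thesis using Suc.IH Nil by simp
    next
      case (Cons x l')
      then have "step e (l, c) = (l', f e x c)" by (simp add: step_def)
      then show ?thesis using Suc.IH Suc.prems Cons by simp
    qed
    finally show ?case .
  qed simp
  have "computable (\<lambda>p. step (fst p) (snd p))"
    unfolding step_def
    by (intro computable_intros computable_compose[OF f, where g = "\<lambda>p. (fst p, hd (fst (snd p)), snd (snd p))", simplified])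
  then have "computable (\<lambda>e. snd ((step e ^^ enc (xs e)) (xs e, a e)))"
    by (intro computable_intros computable_enc xs a)
  then show ?thesis by (simp add: step length_le_enc)
qed

lemma computable_rev [computable_intros]:
  assumes "computable f"
  shows "computable (\<lambda>x. rev (f x))"
  unfolding rev_conv_fold by (intro computable_intros assms)

lemma computable_append [computable_intros]:
  assumes "computable f" "computable g"
  shows "computable (\<lambda>x. f x @ g x)"
proof -
  have "l @ l' = fold Cons (rev l) l'" for l l' :: "'b list"
    by (induction l arbitrary: l') (auto simp flip: foldr_conv_fold)
  moreover have "computable (\<lambda>x. fold Cons (rev (f x)) (g x))"
    by (intro computable_intros assms)
  ultimately show ?thesis by simp
qed

lemma computable_map [computable_intros]:
  assumes "computable (\<lambda>p. f (fst p) (snd p))" "computable xs"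
  shows "computable (\<lambda>e. map (f e) (xs e))"
proof -
  have eq: "map g l = rev (fold (\<lambda>x acc. g x # acc) l [])" for g :: "'b \<Rightarrow> 'c" and l
    by (induction l rule: rev_induct) auto
  show ?thesis unfolding eq
    by (intro computable_intros assms(2) computable_compose2[OF assms(1)])
qed

lemma computable_filter [computable_intros]:
  assumes "decidable (\<lambda>p. P (fst p) (snd p))" "computable xs"
  shows "computable (\<lambda>e. filter (P e) (xs e))"
proof -
  have eq: "filter Q l = rev (fold (\<lambda>x acc. if Q x then x # acc else acc) l [])"
    for Q :: "'b \<Rightarrow> bool" and l
    by (induction l rule: rev_induct) auto
  show ?thesis unfolding eq
    by (intro computable_intros assms(2)
        decidable_compose[OF assms(1), where f = "\<lambda>p. (fst p, fst (snd p))", simplified])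
qed

lemma computable_length [computable_intros]:
  assumes "computable f"
  shows "computable (\<lambda>x. length (f x))"
proof -
  have "length l = fold (\<lambda>_. Suc) l 0" for l :: "'b list"
    by (induction l rule: rev_induct) auto
  moreover have "computable (\<lambda>x. fold (\<lambda>_. Suc) (f x) 0)" by (intro computable_intros assms)
  ultimately show ?thesis by simp
qed

lemma decidable_Ball_set [computable_intros]:
  assumes "decidable (\<lambda>p. P (fst p) (snd p))" "computable xs"
  shows "decidable (\<lambda>e. \<forall>x\<in>set (xs e). P e x)"
proof -
  have "(\<forall>x\<in>set (xs e). P e x) \<longleftrightarrow> filter (\<lambda>x. \<not> P e x) (xs e) = []" for e
    by (auto simp: filter_empty_conv)
  moreover have "decidable (\<lambda>e. filter (\<lambda>x. \<not> P e x) (xs e) = [])"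
    by (intro computable_intros assms)
  ultimately show ?thesis by simp
qed

lemma computable_upt [computable_intros]:
  fixes n :: "'a::coded \<Rightarrow> nat"
  assumes "computable n"
  shows "computable (\<lambda>e. [0..<n e])"
proof -
  have "[0..<k] = rec_nat [] (\<lambda>k r. r @ [k]) k" for k by (induction k) auto
  moreover have "computable (\<lambda>e. rec_nat [] (\<lambda>k r. r @ [k]) (n e))"
    by (intro computable_intros assms)
  ultimately show ?thesis by simp
qed

lemma decidable_all_less [computable_intros]:
  fixes n :: "'a::coded \<Rightarrow> nat"
  assumes "decidable (\<lambda>p. P (fst p) (snd p))" "computable n"
  shows "decidable (\<lambda>e. \<forall>i<n e. P e i)"
proof -
  have "decidable (\<lambda>e. \<forall>i\<in>set [0..<n e]. P e i)" by (intro computable_intros assms)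
  then show ?thesis by (simp add: Ball_def)
qed

lemma decidable_in_set [computable_intros]:
  assumes "computable f" "computable xs"
  shows "decidable (\<lambda>e. f e \<in> set (xs e))"
proof -
  have "f e \<in> set (xs e) \<longleftrightarrow> \<not> (\<forall>y\<in>set (xs e). y \<noteq> f e)" for e by auto
  moreover have "decidable (\<lambda>e. \<not> (\<forall>y\<in>set (xs e). y \<noteq> f e))"
    by (intro computable_intros assms(2) computable_compose[OF assms(1)])
  ultimately show ?thesis by simp
qed

lemma computable_replicate [computable_intros]:
  assumes "computable n" "computable f"
  shows "computable (\<lambda>e. replicate (n e) (f e))"
proof -
  have "replicate (n e) (f e) = map (\<lambda>_. f e) [0..<n e]" for e
    by (simp add: map_replicate_const)
  moreover have "computable (\<lambda>e. map (\<lambda>_. f e) [0..<n e])"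
    by (intro computable_intros assms(1) computable_compose[OF assms(2)])
  ultimately show ?thesis by simp
qed

lemma computable_take_1 [computable_intros]:
  assumes "computable f"
  shows "computable (\<lambda>e. take (Suc 0) (f e))"
proof -
  have "take (Suc 0) l = (if l = [] then [] else [hd l])" for l :: "'b list" by (cases l) auto
  moreover have "computable (\<lambda>e. if f e = [] then [] else [hd (f e)])"
    by (intro computable_intros assms)
  ultimately show ?thesis by simp
qed

text \<open>The value of \<open>nth\<close> beyond the end of a list is unspecified, possibly not computable in the
  index; hence tuples are accessed by \<open>nth_default\<close>.\<close>

lemma computable_nth_default [computable_intros]:
  assumes "computable xs" "computable n"
  shows "computable (\<lambda>e. nth_default d (xs e) (n e))"
proof -
  have "hd ((tl ^^ k) l) = l ! k" if "k < length l" for k and l :: "'b list"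
    using that by (induction k arbitrary: l) (auto simp: hd_conv_nth funpow_swap1 nth_tl)
  then have "nth_default d l k = (if k < length l then hd ((tl ^^ k) l) else d)"
    for k and l :: "'b list" by (simp add: nth_default_def)
  moreover have "computable (\<lambda>e. if n e < length (xs e) then hd ((tl ^^ n e) (xs e)) else d)"
    by (intro computable_intros assms)
  ultimately show ?thesis by simp
qed


section \<open>Semidecidable relations\<close>

definition semidec :: "('a::coded \<Rightarrow> bool) \<Rightarrow> bool" where
  "semidec R \<longleftrightarrow> (\<exists>S. decidable S \<and> (\<forall>x. R x \<longleftrightarrow> (\<exists>w::nat. S (w, x))))"

lemma semidecI:
  fixes S :: "'w::coded \<times> 'a::coded \<Rightarrow> bool"
  assumes S: "decidable S" and R: "\<And>x. R x \<longleftrightarrow> (\<exists>w. S (w, x))"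
  shows "semidec R"
  unfolding semidec_def
proof (intro exI conjI allI)
  \<comment> \<open>The code of \<open>inv enc k\<close> is \<open>k\<close> itself, so a projection
    computes \<open>inv enc\<close>. This admits witnesses of any coded type.\<close>
  have "computable (inv enc :: nat \<Rightarrow> 'w)"
    unfolding computable_def by (auto simp: enc_nat_def intro: recf_eval_Proj_0)
  then have "computable (\<lambda>p :: nat \<times> 'a. inv enc (fst p) :: 'w)"
    by (rule computable_compose) (intro computable_intros)
  then show "decidable (\<lambda>p :: nat \<times> 'a. S (inv enc (fst p), snd p))"
    by (intro decidable_compose[OF S] computable_intros)
  show "R x \<longleftrightarrow> (\<exists>k. S (inv enc (fst (k, x)), snd (k, x)))" for x
    using R[of x] by (metis bij_enc bij_def inv_f_f fst_conv snd_conv)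
qed

lemma semidec_decidable:
  assumes "decidable P"
  shows "semidec P"
proof (rule semidecI)
  show "decidable (\<lambda>p :: nat \<times> _. P (snd p))"
    by (intro decidable_compose[OF assms] computable_intros)
qed simp

lemma semidec_compose:
  assumes "semidec R" "computable f"
  shows "semidec (\<lambda>x. R (f x))"
proof -
  obtain S where S: "decidable S" "\<And>x. R x \<longleftrightarrow> (\<exists>w::nat. S (w, x))"
    using assms(1) unfolding semidec_def by blast
  show ?thesis
  proof (rule semidecI)
    show "decidable (\<lambda>p. S (fst p, f (snd p)))"
      by (intro decidable_compose[OF S(1)] computable_intros computable_compose[OF assms(2)])
  qed (simp add: S(2))
qed

lemma semidec_conj:
  assumes "semidec P" "semidec Q"
  shows "semidec (\<lambda>x. P x \<and> Q x)"
proof -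
  obtain S where S: "decidable S" "\<And>x. P x \<longleftrightarrow> (\<exists>w::nat. S (w, x))"
    using assms(1) unfolding semidec_def by blast
  obtain T where T: "decidable T" "\<And>x. Q x \<longleftrightarrow> (\<exists>w::nat. T (w, x))"
    using assms(2) unfolding semidec_def by blast
  show ?thesis
  proof (rule semidecI)
    show "decidable (\<lambda>p. S (fst (fst p), snd p) \<and> T (snd (fst p), snd p))"
      by (intro computable_intros decidable_compose[OF S(1)] decidable_compose[OF T(1)])
  qed (simp add: S(2) T(2))
qed

lemma semidec_ex:
  fixes R :: "'a::coded \<Rightarrow> 'b::coded \<Rightarrow> bool"
  assumes "semidec (\<lambda>p. R (fst p) (snd p))"
  shows "semidec (\<lambda>x. \<exists>y. R x y)"
proof -
  obtain S where S: "decidable S" "\<And>x. R (fst x) (snd x) \<longleftrightarrow> (\<exists>w::nat. S (w, x))"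
   
    using assms(1) unfolding semidec_def by blast
  show ?thesis
  proof (rule semidecI)
    show "decidable (\<lambda>p. S (fst (fst p), snd p, snd (fst p)))"
      by (intro computable_intros decidable_compose[OF S(1)])
    show "(\<exists>y. R x y) \<longleftrightarrow> (\<exists>w. S (fst (fst (w, x)), snd (w, x), snd (fst (w, x))))" for x
      using S(2)[of "(x, _)"] by auto
  qed
qed

text \<open>A single list collects the witnesses of all instances.\<close>

lemma semidec_all_less:
  fixes n :: "'a::coded \<Rightarrow> nat"
  assumes "semidec (\<lambda>p. R (fst p) (snd p))" "computable n"
  shows "semidec (\<lambda>x. \<forall>i<n x. R x i)"
proof -
  obtain S where S: "decidable S" "\<And>x. R (fst x) (snd x) \<longleftrightarrow> (\<exists>w::nat. S (w, x))"
   
    using assms(1) unfolding semidec_def by blast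
  show ?thesis
  proof (rule semidecI)
    show "decidable (\<lambda>p. length (fst p) = n (snd p) \<and>
        (\<forall>i<n (snd p). S (nth_default 0 (fst p) i, snd p, i)))"
      by (intro computable_intros decidable_compose[OF S(1)] computable_compose[OF assms(2)])
    show "(\<forall>i<n x. R x i) \<longleftrightarrow> (\<exists>w. length (fst (w, x)) = n (snd (w, x)) \<and>
        (\<forall>i<n (snd (w, x)). S (nth_default 0 (fst (w, x)) i, snd (w, x), i)))" for x
      using S(2)[of "(x, _)"] Skolem_list_nth[of "n x" "\<lambda>i w. S (w, x, i)"]
      by (auto simp: nth_default_def)
  qed
qed

text \<open>The number of conjuncts is fixed, and each may have its own semidecision with no
  uniformity in \<open>i\<close>. This is the situation of the inner terms of a composition.\<close>

lemma semidec_finite_conj: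
  fixes N :: nat
  assumes "\<And>i. i < N \<Longrightarrow> semidec (R i)"
  shows "semidec (\<lambda>x. \<forall>i<N. R i x)"
  using assms
proof (induction N)
  case 0
  then show ?case by (simp add: semidec_decidable decidable_const)
next
  case (Suc N)
  have "semidec (\<lambda>x. (\<forall>i<N. R i x) \<and> R N x)" using Suc by (intro semidec_conj) auto
  then show ?case by (simp add: less_Suc_eq all_conj_distrib conj_commute)
qed

lemmas semidec_intros = semidec_conj semidec_ex semidec_all_less

text \<open>The list \<open>ys\<close> holds all intermediate values of the recursion. It replaces
  the inductive rules by one existential and one bounded universal quantifier, both of which
  preserve semidecidability.\<close>

lemma recf_eval_PrimRec_iff:
  "recf_eval (PrimRec f g) (k # xs) z \<longleftrightarrow>
    (\<exists>ys. recf_eval f xs (nth_default 0 ys 0) \<and>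
      (\<forall>i<k. recf_eval g (i # nth_default 0 ys i # xs) (nth_default 0 ys (Suc i))) \<and>
      z = nth_default 0 ys k)" (is "?L k z \<longleftrightarrow> (\<exists>ys. ?R k z ys)")
proof
  show "\<exists>ys. ?R k z ys" if "?L k z"
  proof -
    have "\<exists>ys. length ys = Suc k \<and> ?R k z ys"
      using that
    proof (induction k arbitrary: z)
      case 0
      then have "recf_eval f xs z" by (auto elim: recf_eval_PrimRec_0E)
      then show ?case by (intro exI[of _ "[z]"]) simp
    next
      case (Suc k)
      then obtain y where y: "?L k y" "recf_eval g (k # y # xs) z"
        by (blast elim: recf_eval_PrimRec_SucE)
      obtain ys where ys: "length ys = Suc k" "?R k y ys" using Suc.IH[OF y(1)] by blast
      then have "?R (Suc k) z (ys @ [z])"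
        using y(2) by (auto simp: nth_default_def nth_append less_Suc_eq split: if_splits) (metis Suc_lessD)
      then show ?case using ys(1) by (intro exI[of _ "ys @ [z]"]) simp
    qed
    then show ?thesis by blast
  qed
  show "?L k z" if ex: "\<exists>ys. ?R k z ys"
  proof -
    obtain ys where ys: "?R k z ys" using ex by blast
    have "?L j (nth_default 0 ys j)" if "j \<le> k" for j
      using that
    proof (induction j)
      case 0
      then show ?case using ys by (auto intro: recf_eval.PrimRec_0)
    next
      case (Suc j)
      then show ?case using ys by (auto intro: recf_eval.PrimRec_Suc)
    qed
    then show ?thesis using ys by blast
  qed
qed

text \<open>Induction on the term: every evaluation rule amounts to conjunctions, existential
  quantifiers over coded values and bounded universal quantifiers. This takes the place of a
  universal machine with a step counter.\<close>

theorem semidec_recf_eval: "semidec (\<lambda>p. recf_eval f (fst p) (snd p))"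
proof (induction f)
  case Zero
  have "recf_eval Zero xs z \<longleftrightarrow> z = 0" for xs z
    by (auto elim: recf_eval_ZeroE intro: recf_eval.Zero)
  then show ?case by (simp add: semidec_decidable computable_intros)
next
  case Succ
  have "recf_eval Succ xs z \<longleftrightarrow> xs \<noteq> [] \<and> z = Suc (hd xs)" for xs z
    by (cases xs) (auto elim: recf_eval_SuccE intro: recf_eval.Succ)
  then show ?case by (simp add: semidec_decidable computable_intros)
next
  case (Proj i)
  have "recf_eval (Proj i) xs z \<longleftrightarrow> i < length xs \<and> z = nth_default 0 xs i" for xs z
    by (auto simp: nth_default_def elim: recf_eval_ProjE intro: recf_eval.Proj)
  then show ?case by (simp add: semidec_decidable computable_intros)
next
  case (Comp f gs)
  have eq: "recf_eval (Comp f gs) xs z \<longleftrightarrow> (\<exists>ys. (length ys = length gs \<and>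
      (\<forall>i<length gs. recf_eval (gs ! i) xs (nth_default 0 ys i))) \<and> recf_eval f ys z)" for xs z
    by (auto simp: nth_default_def elim!: recf_eval_CompE intro!: recf_eval.Comp)
  show ?case unfolding eq
    by (intro semidec_ex semidec_conj semidec_finite_conj)
      (auto intro!: computable_intros intro: semidec_decidable
        semidec_compose[OF Comp.IH(1), where f = "\<lambda>p. (snd p, snd (fst p))", simplified]
        semidec_compose[OF Comp.IH(2)[OF nth_mem], where f = "\<lambda>p. (fst (fst p), nth_default 0 (snd p) _)", simplified])
next
  case (PrimRec f g)
  have "recf_eval (PrimRec f g) xs z \<longleftrightarrow> xs \<noteq> [] \<and>
    (\<exists>ys. recf_eval f (tl xs) (nth_default 0 ys 0) \<and>
      (\<forall>i<hd xs. recf_eval g (i # nth_default 0 ys i # tl xs) (nth_default 0 ys (Suc i))) \<and>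
      z = nth_default 0 ys (hd xs))" for xs z
    using recf_eval_PrimRec_iff[of f g "hd xs" "tl xs" z]
    by (cases xs) (auto elim: recf_eval_PrimRecE)
  moreover have "semidec (\<lambda>p. fst p \<noteq> [] \<and>
    (\<exists>ys. recf_eval f (tl (fst p)) (nth_default 0 ys 0) \<and>
      (\<forall>i<hd (fst p). recf_eval g (i # nth_default 0 ys i # tl (fst p)) (nth_default 0 ys (Suc i))) \<and>
      snd p = nth_default 0 ys (hd (fst p))))"
    by (intro semidec_intros
        semidec_compose[OF PrimRec.IH(1), where f = "\<lambda>p. (tl (fst (fst p)), nth_default 0 (snd p) 0)", simplified]
        semidec_compose[OF PrimRec.IH(2), where f = "\<lambda>p. (snd p # nth_default 0 (snd (fst p)) (snd p) #
          tl (fst (fst (fst p))), nth_default 0 (snd (fst p)) (Suc (snd p)))", simplified])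
      (auto intro!: semidec_decidable computable_intros)
  ultimately show ?case by simp
next
  case (Mu f)
  have eq: "recf_eval (Mu f) xs z \<longleftrightarrow> recf_eval f (z # xs) 0 \<and> (\<forall>j<z. \<exists>y. recf_eval f (j # xs) (Suc y))"
    for xs z by (auto elim!: recf_eval_MuE intro!: recf_eval.Mu)
  show ?case unfolding eq
    by (intro semidec_intros
        semidec_compose[OF Mu.IH, where f = "\<lambda>p. (snd p # fst p, 0)", simplified]
        semidec_compose[OF Mu.IH, where f = "\<lambda>p. (snd (fst p) # fst (fst (fst p)), Suc (snd p))", simplified])
      (auto intro!: semidec_decidable computable_intros)
qed

text \<open>Search for a witness together with a value.\<close>

lemma recf_of_semidec_graph:
  fixes G :: "nat \<Rightarrow> nat \<Rightarrow> nat \<Rightarrow> bool"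
  assumes G: "semidec (\<lambda>q. G (fst q) (fst (snd q)) (snd (snd q)))"
    and single: "\<And>a b z z'. G a b z \<Longrightarrow> G a b z' \<Longrightarrow> z = z'"
  shows "\<exists>f. \<forall>a b z. recf_eval f [a, b] z \<longleftrightarrow> G a b z"
proof -
  obtain S where S: "decidable S" "\<And>q. G (fst q) (fst (snd q)) (snd (snd q)) \<longleftrightarrow> (\<exists>w::nat. S (w, q))"
    using G unfolding semidec_def by blast
  let ?T = "\<lambda>k a b. S (fst (prod_decode k), a, b, snd (prod_decode k))"
  \<comment> \<open>\<open>Mu\<close> searches for the value 0, which the negated test takes exactly
    at a hit.\<close>
  have "decidable (\<lambda>q. \<not> ?T (fst q) (fst (snd q)) (snd (snd q)))"
    by (intro computable_intros decidable_compose[OF S(1)])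
  then obtain h where h: "\<And>q. recf_eval h [enc q] (of_bool (\<not> ?T (fst q) (fst (snd q)) (snd (snd q))))"
    unfolding decidable_def computable_def enc_nat_def by blast
  define h' where "h' = Comp h [Comp recf_pair [Proj 0, Comp recf_pair [Proj (Suc 0), Proj 2]]]"
  have h': "recf_eval h' [k, a, b] (of_bool (\<not> ?T k a b))" for k a b
    unfolding h'_def using h[of "(k, a, b)"]
    by (auto simp: enc_prod_def enc_nat_def intro!: recf_eval_intros recf_eval_pair)
  have snd': "recf_eval recf_snd [k] (snd (prod_decode k))" for k
    using recf_eval_snd[of "fst (prod_decode k)" "snd (prod_decode k)" "[]"] by simp
  have "recf_eval (Comp recf_snd [Mu h']) [a, b] z \<longleftrightarrow> G a b z" for a b z
  proof
    assume "recf_eval (Comp recf_snd [Mu h']) [a, b] z"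
    then obtain k where k: "recf_eval (Mu h') [a, b] k" "recf_eval recf_snd [k] z"
      by (auto elim!: recf_eval_CompE simp: length_Suc_conv)
    then have "recf_eval h' [k, a, b] 0" by (auto elim: recf_eval_MuE)
    then have "of_bool (\<not> ?T k a b) = (0::nat)" using h' recf_eval_functional by blast
    then have "?T k a b" by simp
    then have "G a b (snd (prod_decode k))" using S(2)[of "(a, b, snd (prod_decode k))"] by auto
    moreover have "z = snd (prod_decode k)" using k(2) snd' recf_eval_functional by blast
    ultimately show "G a b z" by simp
  next
    assume z: "G a b z"
    then obtain w where "S (w, a, b, z)" using S(2)[of "(a, b, z)"] by auto
    then have ex: "?T (prod_encode (w, z)) a b" by simp
    define k where "k = (LEAST k. ?T k a b)"
    have k: "?T k a b" unfolding k_def using ex by (rule LeastI)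
    have less: "\<not> ?T j a b" if "j < k" for j using that not_less_Least unfolding k_def by blast
    have "recf_eval (Mu h') [a, b] k"
    proof (rule recf_eval.Mu)
      show "recf_eval h' [k, a, b] 0" using h'[of k a b] k by simp
      show "\<forall>j<k. \<exists>y. recf_eval h' [j, a, b] (Suc y)" 
      proof (intro allI impI exI)
        show "recf_eval h' [j, a, b] (Suc 0)" if "j < k" for j
          using h'[of j a b] less[OF that] by simp
      qed
    qed
    then have "recf_eval (Comp recf_snd [Mu h']) [a, b] (snd (prod_decode k))"
      using snd' by (intro recf_eval_Comp1)
    \<comment> \<open>The least hit \<open>k\<close> need not come from the witness
      \<open>w\<close>; single-valuedness still makes its value equal to \<open>z\<close>.\<close>
    moreover have "G a b (snd (prod_decode k))"
      using k S(2)[of "(a, b, snd (prod_decode k))"] by auto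
    ultimately show "recf_eval (Comp recf_snd [Mu h']) [a, b] z" using z single by metis
  qed
  then show ?thesis by blast
qed


section \<open>Complexity and enumeration\<close>

lemma string_code_append: "string_code (xs @ ys) = string_code xs + 2 ^ length xs * string_code ys"
  by (induction xs) (auto simp: algebra_simps)

lemma string_code_replicate_True: "string_code (replicate k True) = 2 * (2 ^ k - 1)"
proof (induction k)
  case (Suc k)
  have "(1::nat) \<le> 2 ^ k" by simp
  then have "2 + 2 * (2 * (2 ^ k - 1)) = (2 * (2 * 2 ^ k - 1) :: nat)" by linarith
  with Suc show ?case by simp
qed simp

lemma string_code_bounds: "2 ^ length s \<le> Suc (string_code s)" "Suc (string_code s) < 2 * 2 ^ length s"
  by (induction s) auto

text \<open>The strings of length \<open>k\<close> occupy a block of consecutive codes. Lengths thus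
  become arithmetic conditions on numbers, which a decidable relation can use.\<close>

lemma length_eq_iff_string_code:
  "length s = k \<longleftrightarrow> 2 ^ k \<le> Suc (string_code s) \<and> Suc (string_code s) < 2 * 2 ^ k"
proof -
  have "a = b" if "(2::nat) ^ a \<le> x" "x < 2 * 2 ^ b" "2 ^ b \<le> x" "x < 2 * 2 ^ a" for a b x :: nat
  proof -
    have "(2::nat) ^ a < 2 ^ Suc b" "(2::nat) ^ b < 2 ^ Suc a" using that by auto
    then show ?thesis by (metis less_antisym less_SucE less_exp power_strict_increasing_iff one_less_numeral_iff semiring_norm(76) not_less_eq)
  qed
  then show ?thesis using string_code_bounds[of s] by metis
qed

lemma obtain_string:
  obtains s where "string_code s = k"
  using surj_string_code by (metis surj_def)

lemma length_less_iff_string_code: "length s < n \<longleftrightarrow> Suc (string_code s) < 2 ^ n"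
proof
  assume "length s < n"
  then have "(2::nat) ^ Suc (length s) \<le> 2 ^ n" by (intro power_increasing) auto
  then show "Suc (string_code s) < 2 ^ n" using string_code_bounds[of s] by simp
next
  assume "Suc (string_code s) < 2 ^ n"
  then have "(2::nat) ^ length s < 2 ^ n" using string_code_bounds[of s] by linarith
  then show "length s < n" by simp
qed

text \<open>A program starts with a self-delimiting description of its first component.\<close>

definition program :: "bool list \<Rightarrow> bool list \<Rightarrow> bool list" where
  "program a u = replicate (length a) True @ False # a @ u"

lemma length_program: "length (program a u) = 2 * length a + 1 + length u"
  by (simp add: program_def)

lemma program_eq_iff: "program a u = program b v \<longleftrightarrow> a = b \<and> u = v"
proof
  assume eq: "program a u = program b v"
  have "takeWhile id (program c w) = replicate (length c) True" for c w
    by (simp add: program_def takeWhile_append)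
  then have "length a = length b" using eq by (metis length_replicate)
  then show "a = b \<and> u = v" using eq by (auto simp: program_def)
qed simp

text \<open>The arithmetic form in which the decoder of \<open>complexity_le_of_enumeration\<close>
  recognises a program.\<close>

lemma string_code_program:
  "string_code (program a u) =
    2 * (2 ^ length a - 1) + 2 ^ length a * (1 + 2 * (string_code a + 2 ^ length a * string_code u))"
  by (simp add: program_def string_code_append string_code_replicate_True)

lemma programming_language_of_semidec_graph:
  fixes G :: "nat \<Rightarrow> nat \<Rightarrow> nat \<Rightarrow> bool"
  assumes G: "semidec (\<lambda>q. G (fst q) (fst (snd q)) (snd (snd q)))"
    and single: "\<And>a b z z'. G a b z \<Longrightarrow> G a b z' \<Longrightarrow> z = z'"
  shows "\<exists>V. programming_language V \<and>
    (\<forall>p y x. V p y = Some x \<longleftrightarrow> G (string_code p) (string_code y) (string_code x))"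
proof -
  define V where "V p y = (if \<exists>x. G (string_code p) (string_code y) (string_code x)
    then Some (SOME x. G (string_code p) (string_code y) (string_code x)) else None)" for p y
  have V: "V p y = Some x \<longleftrightarrow> G (string_code p) (string_code y) (string_code x)" for p y x
  proof -
    have "x = x'" if "G (string_code p) (string_code y) (string_code x)"
      "G (string_code p) (string_code y) (string_code x')" for x x'
      using single[OF that] inj_string_code by (simp add: inj_eq)
    then show ?thesis unfolding V_def by (auto intro: someI2)
  qed
  have "\<exists>f. \<forall>a b z. recf_eval f [a, b] z \<longleftrightarrow> G a b z"
    by (rule recf_of_semidec_graph[OF G]) (erule (1) single)
  then have "programming_language V" unfolding programming_language_def using V by blast
  then show ?thesis using V by blast
qed

text \<open>A program is the self-delimiting description of \<open>a\<close> followed by a string of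
  length \<open>l\<close> that gives the position of \<open>x\<close> in a repetition-free
  enumeration of the set. The decoder reads \<open>l\<close> off as the length of that string, so
  \<open>l\<close> costs no further bits. Finiteness is a separate premise because
  \<open>card\<close> of an infinite set is 0.\<close>

theorem complexity_le_of_enumeration:
  fixes R :: "nat \<Rightarrow> nat \<Rightarrow> nat \<Rightarrow> nat \<Rightarrow> bool"
  assumes U: "optimal_language U"
    and R: "semidec (\<lambda>q. R (fst q) (fst (snd q)) (fst (snd (snd q))) (snd (snd (snd q))))"
  shows "\<exists>c. \<forall>a l y x. R (string_code a) l (string_code y) (string_code x) \<longrightarrow>
    finite {z. R (string_code a) l (string_code y) z} \<longrightarrow>
    card {z. R (string_code a) l (string_code y) z} \<le> 2 ^ l \<longrightarrow>
    cond_complexity U x y \<le> enat (l + 2 * length a + c)"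
proof -
  obtain S where S: "decidable S"
    "\<And>q. R (fst q) (fst (snd q)) (fst (snd (snd q))) (snd (snd (snd q))) \<longleftrightarrow> (\<exists>w::nat. S (w, q))"
    using R unfolding semidec_def by blast
  \<comment> \<open>\<open>t\<close> codes a witness together with a value.\<close>
  define hit where "hit a l y t = S (fst (prod_decode t), a, l, y, snd (prod_decode t))"
    for a l y t :: nat
  define add where "add a l y t L = (if hit a l y t \<and> snd (prod_decode t) \<notin> set L
    then L @ [snd (prod_decode t)] else L)" for a l y t and L :: "nat list"
  define found where "found a l y T = rec_nat [] (add a l y) T" for a l y and T :: nat
  have found_Suc: "found a l y (Suc T) = add a l y T (found a l y T)" for a l y T
    by (simp add: found_def)
  have distinct: "distinct (found a l y T)" for a l y T
    by (induction T) (auto simp: found_def add_def)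
  have set_found: "set (found a l y T) = {snd (prod_decode t) |t. t < T \<and> hit a l y t}" for a l y T
  proof (induction T)
    case 0
    then show ?case by (simp add: found_def)
  next
    case (Suc T)
    then show ?case unfolding found_Suc add_def by (auto simp: less_Suc_eq)
  qed
  have hit_R: "R a l y x \<longleftrightarrow> (\<exists>t. hit a l y t \<and> snd (prod_decode t) = x)" for a l y x
  proof -
    have "R a l y x \<longleftrightarrow> (\<exists>w. S (w, a, l, y, x))" using S(2)[of "(a, l, y, x)"] by simp
    then show ?thesis unfolding hit_def by (metis prod_encode_inverse fst_conv snd_conv)
  qed
  have prefix: "\<exists>zs. found a l y T' = found a l y T @ zs" if "T \<le> T'" for a l y T T'
    using that
  proof (induction rule: dec_induct)
    case (step T')
    then show ?case by (auto simp: found_Suc add_def)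
  qed simp
  \<comment> \<open>Lists of later stages extend those of earlier ones, so the entry at position
    \<open>u\<close> does not depend on the stage at which it is read. This makes the decoder
    single-valued.\<close>
  have stable: "nth_default 0 (found a l y T) u = nth_default 0 (found a l y T') u"
    if "u < length (found a l y T)" "u < length (found a l y T')" for a l y T T' u
  proof -
    have "nth_default 0 (found a l y T) u = nth_default 0 (found a l y T') u"
      if "u < length (found a l y T)" "T \<le> T'" for T T'
      using prefix[OF that(2), of a l y] that(1)
      by (auto simp: nth_default_def nth_append)
    then show ?thesis using that by (metis nat_le_linear)
  qed
  \<comment> \<open>\<open>2 ^ l - 1 + u\<close> is the code of the string at position
    \<open>u\<close> among those of length \<open>l\<close>, and the inequalities force
    \<open>k\<close> to be the length of the string with code \<open>a\<close>.\<close>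
  define H where "H p y x k a l u T \<longleftrightarrow>
      p = 2 * (2 ^ k - 1) + 2 ^ k * (1 + 2 * (a + 2 ^ k * (2 ^ l - 1 + u))) \<and>
      2 ^ k \<le> Suc a \<and> Suc a < 2 * 2 ^ k \<and> u < 2 ^ l \<and> u < length (found a l y T) \<and>
      nth_default 0 (found a l y T) u = x" for p y x k a l u T :: nat
  define G where "G p y x \<longleftrightarrow> (\<exists>k a l u T. H p y x k a l u T)" for p y x
  have H_iff: "H p y x k a l u T \<longleftrightarrow> (\<exists>sa su. p = string_code (program sa su) \<and>
      k = length sa \<and> a = string_code sa \<and> l = length su \<and> Suc (string_code su) = 2 ^ l + u \<and>
      u < length (found a l y T) \<and> nth_default 0 (found a l y T) u = x)" for p y x k a l u T
  proof
    assume H: "H p y x k a l u T"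
    obtain sa where sa: "string_code sa = a" by (rule obtain_string)
    obtain su where su: "string_code su = 2 ^ l - 1 + u" by (rule obtain_string)
    then have su': "Suc (string_code su) = 2 ^ l + u" by simp
    have "length sa = k" "length su = l"
      using H sa su' unfolding length_eq_iff_string_code H_def by auto
    then show "\<exists>sa su. p = string_code (program sa su) \<and>
      k = length sa \<and> a = string_code sa \<and> l = length su \<and> Suc (string_code su) = 2 ^ l + u \<and>
      u < length (found a l y T) \<and> nth_default 0 (found a l y T) u = x"
      using H sa su su' unfolding H_def string_code_program by (intro exI[of _ sa] exI[of _ su]) simp
  next
    assume "\<exists>sa su. p = string_code (program sa su) \<and>
      k = length sa \<and> a = string_code sa \<and> l = length su \<and> Suc (string_code su) = 2 ^ l + u \<and>
      u < length (found a l y T) \<and> nth_default 0 (found a l y T) u = x"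
    then obtain sa su where *: "p = string_code (program sa su)"
      "k = length sa" "a = string_code sa" "l = length su" "Suc (string_code su) = 2 ^ l + u"
      "u < length (found a l y T)" "nth_default 0 (found a l y T) u = x" by blast
    then have "string_code su = 2 ^ l - 1 + u" by simp
    then show "H p y x k a l u T"
      unfolding H_def using * string_code_bounds[of sa] string_code_bounds[of su]
      by (auto simp: string_code_program)
  qed
  have "semidec (\<lambda>q. G (fst q) (fst (snd q)) (snd (snd q)))"
  proof -
    have found_eq: "found a l y T = rec_nat [] (\<lambda>t L. add a l y t L) T" for a l y T
      by (simp add: found_def)
    have "decidable (\<lambda>q. H (fst (fst (fst (fst (fst (fst q)))))) (fst (snd (fst (fst (fst (fst (fst q)))))))
        (snd (snd (fst (fst (fst (fst (fst q))))))) (snd (fst (fst (fst (fst q))))) (snd (fst (fst (fst q))))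
        (snd (fst (fst q))) (snd (fst q)) (snd q))"
      unfolding H_def found_eq add_def hit_def
      by (intro computable_intros decidable_compose[OF S(1)])
    then show ?thesis unfolding G_def by (intro semidec_ex) (rule semidec_decidable)
  qed
  moreover have "z = z'" if "G p y z" "G p y z'" for p y z z'
  proof -
    obtain sa su u T where 1: "p = string_code (program sa su)"
      "Suc (string_code su) = 2 ^ length su + u" "u < length (found (string_code sa) (length su) y T)"
      "nth_default 0 (found (string_code sa) (length su) y T) u = z"
      using \<open>G p y z\<close> unfolding G_def H_iff by blast
    obtain sa' su' u' T' where 2: "p = string_code (program sa' su')"
      "Suc (string_code su') = 2 ^ length su' + u'" "u' < length (found (string_code sa') (length su') y T')"
      "nth_default 0 (found (string_code sa') (length su') y T') u' = z'"
      using \<open>G p y z'\<close> unfolding G_def H_iff by blast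
    have "program sa su = program sa' su'" using 1(1) 2(1) inj_string_code by (simp add: inj_eq)
    then have "sa = sa'" "su = su'" by (simp_all add: program_eq_iff)
    then show ?thesis using 1 2 stable by (metis add_left_cancel)
  qed
  ultimately have "\<exists>V. programming_language V \<and>
    (\<forall>p y x. V p y = Some x \<longleftrightarrow> G (string_code p) (string_code y) (string_code x))"
    by (rule programming_language_of_semidec_graph)
  then obtain V where V: "programming_language V"
    "\<And>p y x. V p y = Some x \<longleftrightarrow> G (string_code p) (string_code y) (string_code x)"
    by blast
  obtain c where c: "\<And>x y. cond_complexity U x y \<le> cond_complexity V x y + enat c"
    using U V(1) unfolding optimal_language_def by blast
  show ?thesis
  proof (intro exI allI impI)
    fix a l y x
    let ?R = "{z. R (string_code a) l (string_code y) z}"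
    let ?found = "found (string_code a) l (string_code y)"
    assume x: "R (string_code a) l (string_code y) (string_code x)"
      and fin: "finite ?R" and card: "card ?R \<le> 2 ^ l"
    obtain t where t: "hit (string_code a) l (string_code y) t" "snd (prod_decode t) = string_code x"
      using x hit_R by blast
    then have "string_code x \<in> set (?found (Suc t))" unfolding set_found by (auto intro!: exI[of _ t])
    then obtain u where u: "u < length (?found (Suc t))" "?found (Suc t) ! u = string_code x"
      by (auto simp: in_set_conv_nth)
    have "set (?found (Suc t)) \<subseteq> ?R" unfolding set_found using hit_R by auto
    then have "length (?found (Suc t)) \<le> 2 ^ l"
      using card_mono[OF fin] card distinct distinct_card by (metis order_trans)
    then have "u < 2 ^ l" using u(1) by simp
    obtain su where su: "string_code su = 2 ^ l - 1 + u" by (rule obtain_string)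
    then have su': "Suc (string_code su) = 2 ^ l + u" by simp
    then have l: "length su = l" using \<open>u < 2 ^ l\<close> unfolding length_eq_iff_string_code by simp
    have "H (string_code (program a su)) (string_code y) (string_code x) (length a) (string_code a) l u (Suc t)"
      unfolding H_iff using u su' l by (intro exI[of _ a] exI[of _ su]) (simp add: nth_default_def)
    then have "V (program a su) y = Some x" unfolding V(2) G_def by blast
    then have "cond_complexity V x y \<le> enat (length (program a su))"
      unfolding cond_complexity_def by (intro INF_lower) simp
    then have "cond_complexity V x y + enat c \<le> enat (length (program a su)) + enat c"
      by (rule add_right_mono)
    \<comment> \<open>The separator bit of \<open>program\<close> goes into the constant.\<close>
    also have "\<dots> = enat (l + 2 * length a + (c + 1))" by (simp add: length_program l)
    finally show "cond_complexity U x y \<le> enat (l + 2 * length a + (c + 1))"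
      using c[of x y] by (rule order_trans[rotated])
  qed
qed


section \<open>The game\<close>

abbreviation entry :: "nat list \<Rightarrow> nat \<Rightarrow> nat" (infixl "!." 100) where
  "xs !. r \<equiv> nth_default 0 xs r"

text \<open>An entry \<open>((i, j), xs)\<close> of the log records that the tuple \<open>xs\<close> broke with cause \<open>(i, j)\<close>.\<close>

type_synonym break_log = "((nat \<times> nat) \<times> nat list) list"

definition breaks :: "break_log \<Rightarrow> nat \<times> nat \<Rightarrow> nat \<Rightarrow> nat \<Rightarrow> nat" where
  "breaks B c r x = length (filter (\<lambda>e. fst e = c \<and> snd e !. r = x) B)"

text \<open>A matrix of numbers rather than a function, so that levels are coded values and can be
  compared.\<close>

definition level :: "nat \<Rightarrow> break_log \<Rightarrow> nat \<Rightarrow> nat \<Rightarrow> nat list list" where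
  "level m B r x = map (\<lambda>i. map (\<lambda>j. breaks B (i, j) r x) [0..<Suc m]) [0..<Suc m]"

text \<open>The association list overrides the initial tuples; the value \<open>[]\<close> marks a single string.\<close>

definition current :: "nat \<Rightarrow> (nat \<times> nat list) list \<Rightarrow> nat \<Rightarrow> nat list" where
  "current m A s = snd (hd (filter (\<lambda>e. fst e = s) A @ [(s, replicate (Suc m) s)]))"

text \<open>To exclude earlier partners it suffices to consult the log: in a play, a string that is
  free in a role belongs to no unbroken tuple in that role.\<close>

definition candidates :: "nat \<Rightarrow> (nat \<times> nat) list \<Rightarrow> break_log \<Rightarrow> nat \<Rightarrow> nat list \<Rightarrow> nat list" where
  "candidates m P B s ys = map snd (filter (\<lambda>z. fst z = length ys \<and>
    level m B (fst z) (snd z) = level m B 0 s \<and>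
    (\<forall>e\<in>set B. snd e !. fst z = snd z \<longrightarrow> (\<forall>q<length ys. snd e !. q \<noteq> ys !. q))) P)"

text \<open>Adds a member in the next role; without a candidate the tuple stays too short forever.\<close>

definition extend :: "nat \<Rightarrow> (nat \<times> nat) list \<Rightarrow> break_log \<Rightarrow> nat \<Rightarrow> nat list \<Rightarrow> nat list" where
  "extend m P B s ys = ys @ take (Suc 0) (candidates m P B s ys)"

definition regroup :: "nat \<Rightarrow> (nat \<times> nat) list \<Rightarrow> break_log \<Rightarrow> nat \<Rightarrow> nat list" where
  "regroup m P B s = (if length ((extend m P B s ^^ m) [s]) = Suc m
    then (extend m P B s ^^ m) [s] else [])"

text \<open>Regrouped tuples, free strings with their roles, and the log.\<close>

type_synonym game_state = "(nat \<times> nat list) list \<times> (nat \<times> nat) list \<times> break_log"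

definition released :: "nat \<Rightarrow> (nat \<times> nat) list \<Rightarrow> nat list \<Rightarrow> (nat \<times> nat) list" where
  "released m P xs = P @ map (\<lambda>r. (r, xs !. r)) [0..<Suc m]"

text \<open>Tuples are indexed by their member in role 0. If regrouping fails, \<open>ys\<close> is
  empty, the filter removes nothing, and all released strings stay free.\<close>

definition break_tuple :: "nat \<Rightarrow> game_state \<Rightarrow> nat \<Rightarrow> nat \<times> nat \<Rightarrow> nat list \<Rightarrow> game_state" where
  "break_tuple m st s c xs =
    (let B = (c, xs) # snd (snd st); P = released m (fst (snd st)) xs; ys = regroup m P B s
     in ((s, ys) # fst st, filter (\<lambda>z. \<not> (fst z < length ys \<and> ys !. fst z = snd z)) P, B))"

text \<open>Stage \<open>t\<close> codes \<open>(s, i, j, w, _)\<close>, the last component making every test recur infinitely often;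
  \<open>rej w a b\<close> means that \<open>w\<close> witnesses \<open>C(a|b) < n\<close>.\<close>

definition game_step :: "nat \<Rightarrow> (nat \<Rightarrow> nat \<Rightarrow> nat \<Rightarrow> bool) \<Rightarrow> nat \<Rightarrow> game_state \<Rightarrow> game_state" where
  "game_step m rej t st =
    (let s = fst (prod_decode t); t1 = snd (prod_decode t);
         i = fst (prod_decode t1); t2 = snd (prod_decode t1);
         j = fst (prod_decode t2); w = fst (prod_decode (snd (prod_decode t2)));
         xs = current m (fst st) s
     in if i \<le> m \<and> j \<le> m \<and> i \<noteq> j \<and> xs \<noteq> [] \<and> rej w (xs !. i) (xs !. j)
        then break_tuple m st s (i, j) xs else st)"

definition game :: "nat \<Rightarrow> (nat \<Rightarrow> nat \<Rightarrow> nat \<Rightarrow> bool) \<Rightarrow> nat \<Rightarrow> game_state" where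
  "game m rej T = rec_nat ([], [], []) (game_step m rej) T"

section \<open>Basic rules of the game and counting tools\<close>

lemma current_Nil: "current m [] s = replicate (Suc m) s"
  by (simp add: current_def)

lemma current_Cons: "current m ((s, ys) # A) = (current m A)(s := ys)"
  by (auto simp: current_def)

lemma breaks_Cons:
  "breaks (e # B) c r x = breaks B c r x + of_bool (fst e = c \<and> snd e !. r = x)"
  by (simp add: breaks_def)

lemma level_eq_iff:
  "level m B r x = level m B' r' x' \<longleftrightarrow>
    (\<forall>i\<le>m. \<forall>j\<le>m. breaks B (i, j) r x = breaks B' (i, j) r' x')"
  by (auto simp: level_def less_Suc_eq_le simp del: upt_Suc)

definition pool :: "nat \<Rightarrow> (nat \<times> nat) set \<Rightarrow> break_log \<Rightarrow> nat \<Rightarrow> nat list list \<Rightarrow> nat set" where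
  "pool m P B r v = {x. (r, x) \<in> P \<and> level m B r x = v}"

lemma finite_pool: "finite P \<Longrightarrow> finite (pool m P B r v)"
  by (rule finite_subset[of _ "snd ` P"]) (force simp: pool_def)+

lemma length_filter_eq_sum:
  assumes "finite C" "\<forall>e\<in>set B. f e \<in> C"
  shows "length (filter Q B) = (\<Sum>c\<in>C. length (filter (\<lambda>e. f e = c \<and> Q e) B))"
  using assms(2)
proof (induction B)
  case (Cons e B)
  have "(\<Sum>c\<in>C. length (filter (\<lambda>e. f e = c \<and> Q e) (e # B))) =
    (\<Sum>c\<in>C. (if f e = c then of_bool (Q e) else 0) + length (filter (\<lambda>e. f e = c \<and> Q e) B))"
    by (rule sum.cong) auto
  also have "\<dots> = of_bool (Q e) + length (filter Q B)"
    using Cons assms(1) by (simp add: sum.distrib)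
  finally show ?case by simp
qed simp

lemma card_le_mult_fibres:
  assumes "finite S" "card (f ` S) \<le> a" "\<And>v. card {x \<in> S. f x = v} \<le> b"
  shows "card S \<le> a * b"
proof -
  have "card S = (\<Sum>v\<in>f ` S. card {x \<in> S. f x = v})"
    using sum.image_gen[OF assms(1), of "\<lambda>_. 1 :: nat" f] by simp
  also have "\<dots> \<le> (\<Sum>v\<in>f ` S. b)" by (intro sum_mono assms(3))
  also have "\<dots> \<le> a * b" using assms(2) by simp
  finally show ?thesis .
qed

text \<open>A finite subset of the union already lies in one stage, and an infinite union would
  contain a subset of size \<open>Suc K\<close>. This carries bounds at finite stages of the game
  over to everything that is ever enumerated.\<close>

lemma card_UN_chain_le:
  fixes S :: "nat \<Rightarrow> 'a set"
  assumes mono: "\<And>i j. i \<le> j \<Longrightarrow> S i \<subseteq> S j" and fin: "\<And>i. finite (S i)" and card: "\<And>i. card (S i) \<le> K"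
  shows "finite (\<Union>i. S i) \<and> card (\<Union>i. S i) \<le> K"
proof -
  have sub: "card F \<le> K" if F: "finite F" "F \<subseteq> (\<Union>i. S i)" for F
  proof -
    have "\<exists>i. F \<subseteq> S i"
      using F
    proof (induction F rule: finite_induct)
      case (insert x F)
      then obtain i j where "F \<subseteq> S i" "x \<in> S j" by auto
      then have "insert x F \<subseteq> S (max i j)"
        using mono[of i "max i j"] mono[of j "max i j"] by auto
      then show ?case by blast
    qed simp
    then obtain i where "F \<subseteq> S i" by blast
    then show ?thesis using card_mono[OF fin] card by (meson order_trans)
  qed
  have "finite (\<Union>i. S i)"
  proof (rule ccontr)
    assume "infinite (\<Union>i. S i)"
    then obtain F where "F \<subseteq> (\<Union>i. S i)" "finite F" "card F = Suc K"
      using infinite_arbitrarily_large by blast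
    then show False using sub[of F] by simp
  qed
  then show ?thesis using sub by blast
qed

text \<open>The strict bound reflects that fewer than \<open>2 ^ n\<close> programs are shorter than
  \<open>n\<close>; it leaves \<open>2 ^ n\<close> possible values for each break count.\<close>

locale matching_game =
  fixes m n :: nat and rej :: "nat \<Rightarrow> nat \<Rightarrow> nat \<Rightarrow> bool"
  assumes finite_rej: "finite {a. \<exists>w. rej w a b}"
    and card_rej: "card {a. \<exists>w. rej w a b} < 2 ^ n"
begin

section \<open>The invariant of the game\<close>

abbreviation "lev \<equiv> level m"

text \<open>The first six clauses make tuples and free strings partition the strings in each role,
  with finitely many free ones. Equal levels inside tuples and equal pool sizes across roles allow
  bounds to be moved from one role to another. The two clauses on pairs ensure that the breaks of a
  string bring ever new partners.\<close>

definition valid :: "(nat \<Rightarrow> nat list) \<Rightarrow> (nat \<times> nat) set \<Rightarrow> break_log \<Rightarrow> bool" where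
  "valid cur P B \<longleftrightarrow>
    (\<forall>s. cur s = [] \<or> length (cur s) = Suc m \<and> cur s !. 0 = s) \<and>
    (\<forall>s. cur s = [] \<longleftrightarrow> (0, s) \<in> P) \<and>
    finite P \<and>
    (\<forall>s r. cur s \<noteq> [] \<longrightarrow> r \<le> m \<longrightarrow> (r, cur s !. r) \<notin> P) \<and>
    (\<forall>s s' r. r \<le> m \<longrightarrow> cur s \<noteq> [] \<longrightarrow> cur s' \<noteq> [] \<longrightarrow> cur s !. r = cur s' !. r \<longrightarrow> s = s') \<and>
    (\<forall>r x. r \<le> m \<longrightarrow> (r, x) \<in> P \<or> (\<exists>s. cur s \<noteq> [] \<and> cur s !. r = x)) \<and>
    (\<forall>s r. cur s \<noteq> [] \<longrightarrow> r \<le> m \<longrightarrow> lev B r (cur s !. r) = lev B 0 s) \<and>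
    (\<forall>e\<in>set B. fst (fst e) \<le> m \<and> snd (fst e) \<le> m \<and> fst (fst e) \<noteq> snd (fst e) \<and>
      (\<exists>w. rej w (snd e !. fst (fst e)) (snd e !. snd (fst e)))) \<and>
    (\<forall>q r. q < r \<longrightarrow> r \<le> m \<longrightarrow> distinct (map (\<lambda>e. (snd e !. q, snd e !. r)) B)) \<and>
    (\<forall>s q r. cur s \<noteq> [] \<longrightarrow> q < r \<longrightarrow> r \<le> m \<longrightarrow>
      (cur s !. q, cur s !. r) \<notin> (\<lambda>e. (snd e !. q, snd e !. r)) ` set B) \<and>
    (\<forall>v r. r \<le> m \<longrightarrow> card (pool m P B r v) = card (pool m P B 0 v))"

lemma validD:
  assumes "valid cur P B"
  shows "cur s = [] \<or> length (cur s) = Suc m \<and> cur s !. 0 = s"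
    and "cur s = [] \<longleftrightarrow> (0, s) \<in> P"
    and "finite P"
    and "cur s \<noteq> [] \<Longrightarrow> r \<le> m \<Longrightarrow> (r, cur s !. r) \<notin> P"
    and "r \<le> m \<Longrightarrow> cur s \<noteq> [] \<Longrightarrow> cur s' \<noteq> [] \<Longrightarrow> cur s !. r = cur s' !. r \<Longrightarrow> s = s'"
    and "r \<le> m \<Longrightarrow> (r, x) \<in> P \<or> (\<exists>s. cur s \<noteq> [] \<and> cur s !. r = x)"
    and "cur s \<noteq> [] \<Longrightarrow> r \<le> m \<Longrightarrow> lev B r (cur s !. r) = lev B 0 s"
    and "e \<in> set B \<Longrightarrow> fst (fst e) \<le> m \<and> snd (fst e) \<le> m \<and> fst (fst e) \<noteq> snd (fst e) \<and>
      (\<exists>w. rej w (snd e !. fst (fst e)) (snd e !. snd (fst e)))"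
    and "q < r \<Longrightarrow> r \<le> m \<Longrightarrow> distinct (map (\<lambda>e. (snd e !. q, snd e !. r)) B)"
    and "cur s \<noteq> [] \<Longrightarrow> q < r \<Longrightarrow> r \<le> m \<Longrightarrow>
      (cur s !. q, cur s !. r) \<notin> (\<lambda>e. (snd e !. q, snd e !. r)) ` set B"
    and "r \<le> m \<Longrightarrow> card (pool m P B r v) = card (pool m P B 0 v)"
proof -
  note V = assms[unfolded valid_def]
  note W = V[THEN conjunct1]
  show "cur s = [] \<or> length (cur s) = Suc m \<and> cur s !. 0 = s" using W by simp
  note W = V[THEN conjunct2, THEN conjunct1]
  show "cur s = [] \<longleftrightarrow> (0, s) \<in> P" using W by simp
  note W = V[THEN conjunct2, THEN conjunct2, THEN conjunct1]
  show "finite P" using W by blast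
  note W = V[THEN conjunct2, THEN conjunct2, THEN conjunct2, THEN conjunct1]
  show "cur s \<noteq> [] \<Longrightarrow> r \<le> m \<Longrightarrow> (r, cur s !. r) \<notin> P" using W by simp
  note W = V[THEN conjunct2, THEN conjunct2, THEN conjunct2, THEN conjunct2, THEN conjunct1]
  show "r \<le> m \<Longrightarrow> cur s \<noteq> [] \<Longrightarrow> cur s' \<noteq> [] \<Longrightarrow> cur s !. r = cur s' !. r \<Longrightarrow> s = s'" using W by simp
  note W = V[THEN conjunct2, THEN conjunct2, THEN conjunct2, THEN conjunct2, THEN conjunct2, THEN conjunct1]
  show "r \<le> m \<Longrightarrow> (r, x) \<in> P \<or> (\<exists>s. cur s \<noteq> [] \<and> cur s !. r = x)" using W by simp
  note W = V[THEN conjunct2, THEN conjunct2, THEN conjunct2, THEN conjunct2, THEN conjunct2, THEN conjunct2, THEN conjunct1]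
  show "cur s \<noteq> [] \<Longrightarrow> r \<le> m \<Longrightarrow> lev B r (cur s !. r) = lev B 0 s" using W by simp
  note W = V[THEN conjunct2, THEN conjunct2, THEN conjunct2, THEN conjunct2, THEN conjunct2, THEN conjunct2, THEN conjunct2, THEN conjunct1]
  show "e \<in> set B \<Longrightarrow> fst (fst e) \<le> m \<and> snd (fst e) \<le> m \<and> fst (fst e) \<noteq> snd (fst e) \<and>
      (\<exists>w. rej w (snd e !. fst (fst e)) (snd e !. snd (fst e)))" using W by simp
  note W = V[THEN conjunct2, THEN conjunct2, THEN conjunct2, THEN conjunct2, THEN conjunct2, THEN conjunct2, THEN conjunct2, THEN conjunct2, THEN conjunct1]
  show "q < r \<Longrightarrow> r \<le> m \<Longrightarrow> distinct (map (\<lambda>e. (snd e !. q, snd e !. r)) B)" using W by simp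
  note W = V[THEN conjunct2, THEN conjunct2, THEN conjunct2, THEN conjunct2, THEN conjunct2, THEN conjunct2, THEN conjunct2, THEN conjunct2, THEN conjunct2, THEN conjunct1]
  show "cur s \<noteq> [] \<Longrightarrow> q < r \<Longrightarrow> r \<le> m \<Longrightarrow>
      (cur s !. q, cur s !. r) \<notin> (\<lambda>e. (snd e !. q, snd e !. r)) ` set B" using W by simp
  note W = V[THEN conjunct2, THEN conjunct2, THEN conjunct2, THEN conjunct2, THEN conjunct2, THEN conjunct2, THEN conjunct2, THEN conjunct2, THEN conjunct2, THEN conjunct2]
  show "r \<le> m \<Longrightarrow> card (pool m P B r v) = card (pool m P B 0 v)" using W by blast
qed

lemma valid_initial: "valid (\<lambda>s. replicate (Suc m) s) {} []"
proof -
  have "replicate (Suc m) s !. r = s" if "r \<le> m" for s r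
    using that by (simp add: nth_default_def del: replicate_Suc)
  then show ?thesis
    unfolding valid_def by (auto simp: pool_def level_eq_iff breaks_def simp del: replicate_Suc)
qed

section \<open>Bounds on break counts and on partners\<close>

lemma breaks_role_less:
  assumes V: "valid cur P B" and ij: "i \<le> m" "j \<le> m"
  shows "breaks B (i, j) j x < 2 ^ n"
proof (cases "i = j")
  case True
  then have "breaks B (i, j) j x = 0"
    unfolding breaks_def using validD(8)[OF V] by (force simp: filter_empty_conv)
  then show ?thesis by simp
next
  case False
  let ?F = "filter (\<lambda>e. fst e = (i, j) \<and> snd e !. j = x) B"
  \<comment> \<open>Pairs never repeat in the log; \<open>valid\<close> records this for increasing
    roles only, hence the case distinction.\<close>
  have "distinct (map (\<lambda>e. (snd e !. i, snd e !. j)) B)"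
  proof (cases "i < j")
    case True
    then show ?thesis using validD(9)[OF V] ij by blast
  next
    case False
    then have "distinct (map (\<lambda>e. (snd e !. j, snd e !. i)) B)"
      using validD(9)[OF V, of j i] ij \<open>i \<noteq> j\<close> by simp
    then show ?thesis by (auto simp: distinct_map inj_on_def)
  qed
  \<comment> \<open>With the entry in role \<open>j\<close> fixed at \<open>x\<close>, distinct
    pairs have distinct entries in role \<open>i\<close>, all of them rejected against
    \<open>x\<close>.\<close>
  then have "distinct (map (\<lambda>e. snd e !. i) ?F)"
    by (auto simp: distinct_map inj_on_def)
  then have "breaks B (i, j) j x = card (set (map (\<lambda>e. snd e !. i) ?F))"
    unfolding breaks_def by (simp only: distinct_card length_map)
  also have "\<dots> \<le> card {a. \<exists>w. rej w a x}"
    using validD(8)[OF V] by (intro card_mono finite_rej) force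
  also have "\<dots> < 2 ^ n" by (rule card_rej)
  finally show ?thesis .
qed

lemma breaks_less:
  assumes V: "valid cur P B" and ij: "i \<le> m" "j \<le> m" and r: "r \<le> m"
  shows "breaks B (i, j) r x < 2 ^ n"
proof -
  \<comment> \<open>A string in role \<open>j\<close> on the level of \<open>x\<close>: if
    \<open>x\<close> is free, the pools of its level have equal size in both roles; otherwise the
    tuple of \<open>x\<close> has a member in role \<open>j\<close>.\<close>
  obtain y where "lev B j y = lev B r x"
  proof (cases "(r, x) \<in> P")
    case True
    then have "card (pool m P B r (lev B r x)) > 0"
      using finite_pool[OF validD(3)[OF V]] by (auto simp: card_gt_0_iff pool_def)
    then have "card (pool m P B j (lev B r x)) > 0"
      using validD(11)[OF V ij(2)] validD(11)[OF V r] by simp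
    then show ?thesis using that by (force simp: card_gt_0_iff pool_def)
  next
    case False
    then obtain s where "cur s \<noteq> []" "cur s !. r = x" using validD(6)[OF V r] by blast
    then show ?thesis using that validD(7)[OF V] ij r by metis
  qed
  then have "breaks B (i, j) r x = breaks B (i, j) j y" using ij by (simp add: level_eq_iff)
  then show ?thesis using breaks_role_less[OF V ij] by simp
qed

text \<open>Bounds the broken tuples with a given string in a given role:
  \<open>(m + 1)\<^sup>2\<close> pairs \<open>(i, j)\<close>, each with fewer than
  \<open>2 ^ n\<close> breaks.\<close>

definition cap :: nat where "cap = (m + 1)\<^sup>2 * 2 ^ n"

lemma uses_le:
  assumes V: "valid cur P B" and r: "r \<le> m"
  shows "length (filter (\<lambda>e. snd e !. r = x) B) \<le> cap"
proof -
  have "length (filter (\<lambda>e. snd e !. r = x) B) =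
      (\<Sum>c\<in>{..m} \<times> {..m}. length (filter (\<lambda>e. fst e = c \<and> snd e !. r = x) B))"
    using validD(8)[OF V] by (intro length_filter_eq_sum) (auto simp: mem_Times_iff)
  also have "\<dots> \<le> (\<Sum>c\<in>{..m} \<times> {..m}. 2 ^ n)"
  proof (rule sum_mono)
    fix c assume "c \<in> {..m} \<times> {..m}"
    then show "length (filter (\<lambda>e. fst e = c \<and> snd e !. r = x) B) \<le> 2 ^ n"
      using breaks_less[OF V _ _ r, of "fst c" "snd c" x] unfolding breaks_def by auto
  qed
  also have "\<dots> = cap" by (simp add: cap_def power2_eq_square)
  finally show ?thesis .
qed

lemma finite_partners: "finite {snd e !. q |e. e \<in> set B \<and> snd e !. r = x}" for B :: break_log
  by (rule finite_subset[of _ "(\<lambda>e. snd e !. q) ` set B"]) blast+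

lemma card_partners_le:
  assumes V: "valid cur P B" and r: "r \<le> m"
  shows "card {snd e !. q |e. e \<in> set B \<and> snd e !. r = x} \<le> cap"
proof -
  have eq: "{snd e !. q |e. e \<in> set B \<and> snd e !. r = x} =
      set (map (\<lambda>e. snd e !. q) (filter (\<lambda>e. snd e !. r = x) B))"
    unfolding set_map set_filter by blast
  have "card {snd e !. q |e. e \<in> set B \<and> snd e !. r = x} \<le>
      length (map (\<lambda>e. snd e !. q) (filter (\<lambda>e. snd e !. r = x) B))"
    unfolding eq by (rule card_length)
  then show ?thesis using uses_le[OF V r, of x] by simp
qed

section \<open>Breaking a tuple\<close>

lemma lev_break:
  assumes V: "valid cur P B" and s: "cur s = xs" "xs \<noteq> []" and r: "r \<le> m"
  shows "lev ((c, xs) # B) r (xs !. r) = lev ((c, xs) # B) 0 s"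
    and "x \<noteq> xs !. r \<Longrightarrow> lev ((c, xs) # B) r x = lev B r x"
  \<comment> \<open>The members had equal levels, and the break raises the same matrix entry for
    each of them.\<close>
  using validD(7)[OF V, of s r] validD(1)[OF V, of s] s r
  by (auto simp: level_eq_iff breaks_Cons)

text \<open>Every role releases one string, and all of them land on the same new level; therefore
  pool sizes remain equal across roles.\<close>

lemma pool_break:
  assumes V: "valid cur P B" and s: "cur s = xs" "xs \<noteq> []" and r: "r \<le> m"
  shows "pool m (P \<union> {(r, xs !. r) |r. r \<le> m}) ((c, xs) # B) r v =
    (if v = lev ((c, xs) # B) 0 s then insert (xs !. r) (pool m P B r v) else pool m P B r v)"
    and "xs !. r \<notin> pool m P B r v"
proof -
  have notin: "(r, xs !. r) \<notin> P" using validD(4)[OF V, of s r] s r by simp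
  then show "xs !. r \<notin> pool m P B r v" by (simp add: pool_def)
  have "x \<in> pool m (P \<union> {(r, xs !. r) |r. r \<le> m}) ((c, xs) # B) r v \<longleftrightarrow>
    x = xs !. r \<and> v = lev ((c, xs) # B) 0 s \<or> x \<in> pool m P B r v" for x
    using lev_break[OF V s r, where c = c] notin r by (cases "x = xs !. r") (auto simp: pool_def)
  then show "pool m (P \<union> {(r, xs !. r) |r. r \<le> m}) ((c, xs) # B) r v =
    (if v = lev ((c, xs) # B) 0 s then insert (xs !. r) (pool m P B r v) else pool m P B r v)"
    by auto
qed

lemma card_pool_break:
  assumes V: "valid cur P B" and s: "cur s = xs" "xs \<noteq> []" and r: "r \<le> m"
  shows "card (pool m (P \<union> {(r, xs !. r) |r. r \<le> m}) ((c, xs) # B) r v) =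
    card (pool m P B r v) + of_bool (v = lev ((c, xs) # B) 0 s)"
  using pool_break[OF V s r] finite_pool[OF validD(3)[OF V]] by simp

text \<open>Describes the state between break and regrouping, when all members of \<open>xs\<close>
  are free.\<close>

lemma valid_break:
  assumes V: "valid cur P B" and s: "cur s = xs" "xs \<noteq> []"
    and c: "fst c \<le> m" "snd c \<le> m" "fst c \<noteq> snd c" "rej w (xs !. fst c) (xs !. snd c)"
  shows "valid (cur(s := [])) (P \<union> {(r, xs !. r) |r. r \<le> m}) ((c, xs) # B)"
  unfolding valid_def
proof (intro conjI allI impI)
  let ?P = "P \<union> {(r, xs !. r) |r. r \<le> m}" and ?cur = "cur(s := [])" and ?B = "(c, xs) # B"
  have xs: "length xs = Suc m" "xs !. 0 = s" using validD(1)[OF V, of s] s by auto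
  have other: "cur s' !. r \<noteq> xs !. r" if "?cur s' \<noteq> []" "r \<le> m" for s' r
    using that validD(5)[OF V, of r s s'] s by (auto split: if_splits)
  show "?cur s' = [] \<or> length (?cur s') = Suc m \<and> ?cur s' !. 0 = s'" for s'
    using validD(1)[OF V, of s'] by auto
  show "?cur s' = [] \<longleftrightarrow> (0, s') \<in> ?P" for s'
    using validD(2)[OF V, of s'] xs by auto
  show "finite ?P" using validD(3)[OF V] by simp
  show "(r, ?cur s' !. r) \<notin> ?P" if "?cur s' \<noteq> []" "r \<le> m" for s' r
    using that other[OF that] validD(4)[OF V, of s' r] by (auto split: if_splits)
  show "s' = s''" if "r \<le> m" "?cur s' \<noteq> []" "?cur s'' \<noteq> []" "?cur s' !. r = ?cur s'' !. r"
    for s' s'' r using that validD(5)[OF V, of r s' s''] by (auto split: if_splits)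
  show "(r, x) \<in> ?P \<or> (\<exists>s'. ?cur s' \<noteq> [] \<and> ?cur s' !. r = x)" if "r \<le> m" for r x
    using validD(6)[OF V that, of x] s that by auto
  show "lev ?B r (?cur s' !. r) = lev ?B 0 s'" if "?cur s' \<noteq> []" "r \<le> m" for s' r
  proof -
    have s': "s' \<noteq> s" "cur s' \<noteq> []" using that by (auto split: if_splits)
    have "lev ?B r (cur s' !. r) = lev B r (cur s' !. r)"
      using lev_break(2)[OF V s that(2)] other[OF that] by blast
    also have "\<dots> = lev B 0 s'" using validD(7)[OF V s'(2) that(2)] .
    also have "\<dots> = lev ?B 0 s'" using lev_break(2)[OF V s, of 0 s'] xs s' by simp
    finally show ?thesis using s' by simp
  qed
  show "\<forall>e\<in>set ?B. fst (fst e) \<le> m \<and> snd (fst e) \<le> m \<and> fst (fst e) \<noteq> snd (fst e) \<and>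
      (\<exists>w. rej w (snd e !. fst (fst e)) (snd e !. snd (fst e)))"
    using c validD(8)[OF V] by auto
  \<comment> \<open>The pairs of \<open>xs\<close> are new to the log because pairs from unbroken
    tuples never occur in it.\<close>
  show "distinct (map (\<lambda>e. (snd e !. q, snd e !. r)) ?B)" if "q < r" "r \<le> m" for q r
    using validD(9)[OF V that] validD(10)[OF V, of s q r] that s by auto
  show "(?cur s' !. q, ?cur s' !. r) \<notin> (\<lambda>e. (snd e !. q, snd e !. r)) ` set ?B"
    if "?cur s' \<noteq> []" "q < r" "r \<le> m" for s' q r
    using validD(10)[OF V, of s' q r] other[OF that(1,3)] that by (auto split: if_splits)
  show "card (pool m ?P ?B r v) = card (pool m ?P ?B 0 v)" if "r \<le> m" for v r
    using card_pool_break[OF V s that] card_pool_break[OF V s, of 0] validD(11)[OF V that] by simp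
qed

section \<open>Forming a new tuple\<close>

definition admissible :: "(nat \<times> nat) set \<Rightarrow> break_log \<Rightarrow> nat \<Rightarrow> nat list \<Rightarrow> bool" where
  "admissible P B s ys \<longleftrightarrow> ys \<noteq> [] \<and> ys !. 0 = s \<and>
    (\<forall>r<length ys. (r, ys !. r) \<in> P \<and> lev B r (ys !. r) = lev B 0 s \<and>
      (\<forall>q<r. (ys !. q, ys !. r) \<notin> (\<lambda>e. (snd e !. q, snd e !. r)) ` set B))"

text \<open>The new tuple takes one string of the level of \<open>s\<close> out of each role; the
  additive form avoids truncated subtraction.\<close>

lemma pool_form:
  assumes V: "valid cur P B" and ys: "admissible P B s ys" "length ys = Suc m" and r: "r \<le> m"
  shows "card (pool m (P - {(r, ys !. r) |r. r \<le> m}) B r v) + of_bool (v = lev B 0 s) =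
    card (pool m P B r v)"
proof -
  have y: "(r, ys !. r) \<in> P" "lev B r (ys !. r) = lev B 0 s"
    using ys r unfolding admissible_def by auto
  have "pool m (P - {(r, ys !. r) |r. r \<le> m}) B r v = pool m P B r v - {ys !. r}"
    using r by (auto simp: pool_def)
  then show ?thesis
    using y card_Suc_Diff1[OF finite_pool[OF validD(3)[OF V]], of "ys !. r" m B r v]
    by (auto simp: pool_def)
qed

lemma valid_form:
  assumes V: "valid cur P B" and ys: "admissible P B s ys" "length ys = Suc m"
  shows "valid (cur(s := ys)) (P - {(r, ys !. r) |r. r \<le> m}) B"
  unfolding valid_def
proof (intro conjI allI impI)
  let ?P = "P - {(r, ys !. r) |r. r \<le> m}" and ?cur = "cur(s := ys)"
  have ysD: "(r, ys !. r) \<in> P" "lev B r (ys !. r) = lev B 0 s"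
    "q < r \<Longrightarrow> (ys !. q, ys !. r) \<notin> (\<lambda>e. (snd e !. q, snd e !. r)) ` set B" if "r \<le> m" for q r
    using ys that unfolding admissible_def by auto
  have y0: "ys !. 0 = s" "ys \<noteq> []" using ys unfolding admissible_def by auto
  then have s: "cur s = []" using ysD(1)[of 0] validD(2)[OF V, of s] by simp
  have other: "cur s' !. r \<noteq> ys !. r" if "cur s' \<noteq> []" "r \<le> m" for s' r
    using validD(4)[OF V that] ysD(1)[OF that(2)] by metis
  show "?cur s' = [] \<or> length (?cur s') = Suc m \<and> ?cur s' !. 0 = s'" for s'
    using validD(1)[OF V, of s'] ys y0 by auto
  show "?cur s' = [] \<longleftrightarrow> (0, s') \<in> ?P" for s'
    using validD(2)[OF V, of s'] y0 by auto
  show "finite ?P" using validD(3)[OF V] by simp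
  show "(r, ?cur s' !. r) \<notin> ?P" if "?cur s' \<noteq> []" "r \<le> m" for s' r
    using that validD(4)[OF V, of s' r] by (auto split: if_splits)
  show "s' = s''" if "r \<le> m" "?cur s' \<noteq> []" "?cur s'' \<noteq> []" "?cur s' !. r = ?cur s'' !. r"
    for s' s'' r using that validD(5)[OF V, of r s' s''] other by (auto split: if_splits) metis
  show "(r, x) \<in> ?P \<or> (\<exists>s'. ?cur s' \<noteq> [] \<and> ?cur s' !. r = x)" if r: "r \<le> m" for r x
  proof (cases "x = ys !. r")
    case True
    then show ?thesis using y0(2) by (intro disjI2 exI[of _ s]) simp
  next
    case False
    consider "(r, x) \<in> P" | s' where "cur s' \<noteq> []" "cur s' !. r = x"
      using validD(6)[OF V r, of x] by blast
    then show ?thesis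
    proof cases
      case 1
      then show ?thesis using False by simp
    next
      case (2 s')
      then have "s' \<noteq> s" using s by auto
      then show ?thesis using 2 by (intro disjI2 exI[of _ s']) simp
    qed
  qed
  show "lev B r (?cur s' !. r) = lev B 0 s'" if "?cur s' \<noteq> []" "r \<le> m" for s' r
    using validD(7)[OF V, of s' r] ysD(2) that by auto
  show "\<forall>e\<in>set B. fst (fst e) \<le> m \<and> snd (fst e) \<le> m \<and> fst (fst e) \<noteq> snd (fst e) \<and>
      (\<exists>w. rej w (snd e !. fst (fst e)) (snd e !. snd (fst e)))"
    using validD(8)[OF V] by blast
  show "distinct (map (\<lambda>e. (snd e !. q, snd e !. r)) B)" if "q < r" "r \<le> m" for q r
    using validD(9)[OF V that] .
  show "(?cur s' !. q, ?cur s' !. r) \<notin> (\<lambda>e. (snd e !. q, snd e !. r)) ` set B"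
    if "?cur s' \<noteq> []" "q < r" "r \<le> m" for s' q r
  proof (cases "s' = s")
    case True
    then show ?thesis using ysD(3)[OF that(3,2)] by simp
  next
    case False
    then show ?thesis using validD(10)[OF V _ that(2,3), of s'] that(1) by simp
  qed
  show "card (pool m ?P B r v) = card (pool m ?P B 0 v)" if "r \<le> m" for v r
    using pool_form[OF V ys that, of v] pool_form[OF V ys, of 0 v] validD(11)[OF V that, of v] by simp
qed

lemma admissible_extend:
  assumes "admissible (set P) B s ys"
  shows "admissible (set P) B s (extend m P B s ys)"
proof (cases "candidates m P B s ys")
  case Nil
  then show ?thesis using assms by (simp add: extend_def)
next
  case (Cons x xs)
  then have "x \<in> set (candidates m P B s ys)" by simp
  then have x: "(length ys, x) \<in> set P" "lev B (length ys) x = lev B 0 s"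
    "\<And>e q. e \<in> set B \<Longrightarrow> snd e !. length ys = x \<Longrightarrow> q < length ys \<Longrightarrow> snd e !. q \<noteq> ys !. q"
    unfolding candidates_def by auto
  have ext: "extend m P B s ys = ys @ [x]" by (simp add: extend_def Cons)
  have old: "(ys @ [x]) !. r = ys !. r" if "r < length ys" for r
    using that by (simp add: nth_default_def nth_append)
  have new: "(ys @ [x]) !. length ys = x" by (simp add: nth_default_def)
  have ys: "ys \<noteq> []" "ys !. 0 = s"
    "\<And>r. r < length ys \<Longrightarrow> (r, ys !. r) \<in> set P \<and> lev B r (ys !. r) = lev B 0 s \<and>
      (\<forall>q<r. (ys !. q, ys !. r) \<notin> (\<lambda>e. (snd e !. q, snd e !. r)) ` set B)"
    using assms unfolding admissible_def by auto
  show ?thesis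
    unfolding ext admissible_def
  proof (intro conjI allI impI)
    show "ys @ [x] \<noteq> []" by simp
    show "(ys @ [x]) !. 0 = s" using ys(1,2) old[of 0] by simp
    fix r assume "r < length (ys @ [x])"
    then consider "r < length ys" | "r = length ys" by fastforce
    then have "(r, (ys @ [x]) !. r) \<in> set P \<and> lev B r ((ys @ [x]) !. r) = lev B 0 s \<and>
      (\<forall>q<r. ((ys @ [x]) !. q, (ys @ [x]) !. r) \<notin> (\<lambda>e. (snd e !. q, snd e !. r)) ` set B)"
    proof cases
      case 1
      then show ?thesis using ys(3)[OF 1] old by simp
    next
      case 2
      have "(ys !. q, x) \<notin> (\<lambda>e. (snd e !. q, snd e !. length ys)) ` set B" if "q < length ys" for q
      proof
        assume "(ys !. q, x) \<in> (\<lambda>e. (snd e !. q, snd e !. length ys)) ` set B"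
        then obtain e where "e \<in> set B" "snd e !. q = ys !. q" "snd e !. length ys = x"
          by (elim imageE) simp
        then show False using x(3)[of e q] that by simp
      qed
      then show ?thesis using 2 x(1,2) old new by simp
    qed
    then show "(r, (ys @ [x]) !. r) \<in> set P" "lev B r ((ys @ [x]) !. r) = lev B 0 s"
      "\<And>q. q < r \<Longrightarrow> ((ys @ [x]) !. q, (ys @ [x]) !. r) \<notin> (\<lambda>e. (snd e !. q, snd e !. r)) ` set B"
      by blast+
  qed
qed

text \<open>Each free string of this level and role has already met one of the at most
  \<open>m\<close> chosen members, and each of those has met at most \<open>cap\<close> strings in
  that role.\<close>

lemma candidates_Nil_imp:
  assumes V: "valid cur (set P) B" and ys: "admissible (set P) B s ys" "length ys \<le> m"
    and Nil: "candidates m P B s ys = []"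
  shows "card (pool m (set P) B (length ys) (lev B 0 s)) \<le> m * cap"
proof -
  let ?S = "\<lambda>q. {snd e !. length ys |e. e \<in> set B \<and> snd e !. q = ys !. q}"
  have "pool m (set P) B (length ys) (lev B 0 s) \<subseteq> (\<Union>q<length ys. ?S q)"
  proof
    fix x assume "x \<in> pool m (set P) B (length ys) (lev B 0 s)"
    then have x: "(length ys, x) \<in> set P" "lev B (length ys) x = lev B 0 s" by (auto simp: pool_def)
    moreover have "x \<notin> set (candidates m P B s ys)" using Nil by simp
    ultimately have "\<not> (\<forall>e\<in>set B. snd e !. length ys = x \<longrightarrow> (\<forall>q<length ys. snd e !. q \<noteq> ys !. q))"
      unfolding candidates_def by force
    then show "x \<in> (\<Union>q<length ys. ?S q)" by blast
  qed
  then have "card (pool m (set P) B (length ys) (lev B 0 s)) \<le> card (\<Union>q<length ys. ?S q)"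
    using finite_partners by (intro card_mono finite_UN_I) simp_all
  also have "\<dots> \<le> (\<Sum>q<length ys. card (?S q))" by (rule card_UN_le) simp
  also have "\<dots> \<le> (\<Sum>q<length ys. cap)" using ys(2) by (intro sum_mono card_partners_le[OF V]) auto
  also have "\<dots> \<le> m * cap" using ys(2) by simp
  finally show ?thesis .
qed

text \<open>If the extension gets stuck, the pool of the next role is small, and pools of one level
  are equally large in all roles, so the pool of role 0 is small too.\<close>

lemma regroup_cases:
  assumes V: "valid cur (set P) B" and s: "(0, s) \<in> set P"
  shows "admissible (set P) B s (regroup m P B s) \<and> length (regroup m P B s) = Suc m \<or>
    regroup m P B s = [] \<and> card (pool m (set P) B 0 (lev B 0 s)) \<le> m * cap"
proof -
  let ?ys = "\<lambda>k. (extend m P B s ^^ k) [s]"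
  have "admissible (set P) B s (?ys k) \<and>
    (length (?ys k) = Suc k \<or> length (?ys k) \<le> k \<and> candidates m P B s (?ys k) = [])" for k
  proof (induction k)
    case 0
    then show ?case using s by (simp add: admissible_def nth_default_def)
  next
    case (Suc k)
    then have "admissible (set P) B s (?ys (Suc k))" by (simp add: admissible_extend)
    moreover have "?ys (Suc k) = ?ys k @ take (Suc 0) (candidates m P B s (?ys k))"
      unfolding funpow.simps comp_apply by (rule extend_def)
    then have "length (?ys (Suc k)) = Suc (Suc k) \<or>
        length (?ys (Suc k)) \<le> Suc k \<and> candidates m P B s (?ys (Suc k)) = []"
      using Suc by (cases "candidates m P B s (?ys k)") (auto simp del: funpow.simps)
    ultimately show ?case by blast
  qed
  from this[of m] have adm: "admissible (set P) B s (?ys m)"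
    and len: "length (?ys m) = Suc m \<or> length (?ys m) \<le> m \<and> candidates m P B s (?ys m) = []" by auto
  show ?thesis
  proof (cases "length (?ys m) = Suc m")
    case True
    then show ?thesis using adm by (simp add: regroup_def)
  next
    case False
    with len have "length (?ys m) \<le> m" "candidates m P B s (?ys m) = []" by auto
    then have "card (pool m (set P) B 0 (lev B 0 s)) \<le> m * cap"
      using candidates_Nil_imp[OF V adm] validD(11)[OF V, of "length (?ys m)"] by simp
    then show ?thesis using False by (simp add: regroup_def)
  qed
qed

section \<open>The invariant along the play\<close>

definition good :: "game_state \<Rightarrow> bool" where
  "good st \<longleftrightarrow> valid (current m (fst st)) (set (fst (snd st))) (snd (snd st)) \<and>
    (\<forall>v. card (pool m (set (fst (snd st))) (snd (snd st)) 0 v) \<le> m * cap)"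

text \<open>In role 0 only the new level of \<open>s\<close> gains a free string. If a tuple forms,
  \<open>s\<close> leaves that pool again and the old bound persists; if none forms, the failure
  itself bounds the pool.\<close>

lemma good_break_tuple:
  assumes st: "good st" and xs: "current m (fst st) s = xs" "xs \<noteq> []"
    and c: "fst c \<le> m" "snd c \<le> m" "fst c \<noteq> snd c" "rej w (xs !. fst c) (xs !. snd c)"
  shows "good (break_tuple m st s c xs)"
proof -
  obtain A P B where [simp]: "st = (A, P, B)" by (metis prod_cases3)
  let ?B = "(c, xs) # B" and ?P = "released m P xs" and ?cur = "current m A"
  have V: "valid ?cur (set P) B" and bound: "\<And>v. card (pool m (set P) B 0 v) \<le> m * cap"
    and s: "?cur s = xs" using st xs by (auto simp: good_def)
  have P: "set ?P = set P \<union> {(r, xs !. r) |r. r \<le> m}"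
    by (auto simp: released_def less_Suc_eq_le simp del: upt_Suc)
  have V': "valid (?cur(s := [])) (set ?P) ?B"
    unfolding P using valid_break[OF V s xs(2) c] .
  have card': "card (pool m (set ?P) ?B 0 v) = card (pool m (set P) B 0 v) + of_bool (v = lev ?B 0 s)"
    for v unfolding P by (rule card_pool_break[OF V s xs(2)]) simp
  have "(0, s) \<in> set ?P" using validD(2)[OF V', of s] by simp
  then consider
    (form) "admissible (set ?P) ?B s (regroup m ?P ?B s)" "length (regroup m ?P ?B s) = Suc m" |
    (fail) "regroup m ?P ?B s = []" "card (pool m (set ?P) ?B 0 (lev ?B 0 s)) \<le> m * cap"
    using regroup_cases[OF V'] by blast
  then show ?thesis
  proof cases
    case form
    let ?ys = "regroup m ?P ?B s"
    have P': "set (filter (\<lambda>z. \<not> (fst z < length ?ys \<and> ?ys !. fst z = snd z)) ?P) =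
        set ?P - {(r, ?ys !. r) |r. r \<le> m}"
      using form(2) by auto
    have "valid (?cur(s := ?ys)) (set ?P - {(r, ?ys !. r) |r. r \<le> m}) ?B"
      using valid_form[OF V' form] by simp
    moreover have "card (pool m (set ?P - {(r, ?ys !. r) |r. r \<le> m}) ?B 0 v) \<le> m * cap" for v
      using pool_form[OF V' form, of 0 v] card'[of v] bound[of v] by simp
    moreover have "break_tuple m st s c xs = ((s, ?ys) # A,
        filter (\<lambda>z. \<not> (fst z < length ?ys \<and> ?ys !. fst z = snd z)) ?P, ?B)"
      unfolding break_tuple_def Let_def by simp
    ultimately show ?thesis
      unfolding good_def by (simp only: P' fst_conv snd_conv current_Cons) simp
  next
    case fail
    have "card (pool m (set ?P) ?B 0 v) \<le> m * cap" for v
      using fail(2) card'[of v] bound[of v] by (cases "v = lev ?B 0 s") auto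
    then show ?thesis
      using V' fail(1) unfolding good_def break_tuple_def Let_def by (simp add: current_Cons)
  qed
qed

lemma game_Suc: "game m rej (Suc T) = game_step m rej T (game m rej T)"
  by (simp add: game_def)

abbreviation "cur T \<equiv> current m (fst (game m rej T))"
abbreviation "free T \<equiv> set (fst (snd (game m rej T)))"
abbreviation "history T \<equiv> snd (snd (game m rej T))"

lemma game_step_cases:
  obtains (stay) "game_step m rej t st = st"
  | (break) s c xs w where "game_step m rej t st = break_tuple m st s c xs"
      "current m (fst st) s = xs" "xs \<noteq> []" "fst c \<le> m" "snd c \<le> m" "fst c \<noteq> snd c"
      "rej w (xs !. fst c) (xs !. snd c)"
proof -
  let ?s = "fst (prod_decode t)" and ?t = "snd (prod_decode t)"
  let ?i = "fst (prod_decode ?t)" and ?t' = "snd (prod_decode ?t)"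
  let ?j = "fst (prod_decode ?t')" and ?w = "fst (prod_decode (snd (prod_decode ?t')))"
  let ?xs = "current m (fst st) ?s"
  have eq: "game_step m rej t st = (if ?i \<le> m \<and> ?j \<le> m \<and> ?i \<noteq> ?j \<and> ?xs \<noteq> [] \<and> rej ?w (?xs !. ?i) (?xs !. ?j)
      then break_tuple m st ?s (?i, ?j) ?xs else st)"
    unfolding game_step_def Let_def ..
  show ?thesis
  proof (cases "?i \<le> m \<and> ?j \<le> m \<and> ?i \<noteq> ?j \<and> ?xs \<noteq> [] \<and> rej ?w (?xs !. ?i) (?xs !. ?j)")
    case True
    then show ?thesis using break[of ?s "(?i, ?j)" ?xs ?w] eq by simp
  next
    case False
    then show ?thesis using stay eq by argo
  qed
qed

lemma good_game: "good (game m rej T)"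
proof (induction T)
  case 0
  have "current m [] = (\<lambda>s. replicate (Suc m) s)" by (rule ext) (rule current_Nil)
  then show ?case using valid_initial by (simp add: good_def game_def pool_def del: replicate_Suc)
next
  case (Suc T)
  show ?case
    by (rule game_step_cases[of T "game m rej T"]) (auto simp: game_Suc Suc intro: good_break_tuple)
qed

lemma valid_game: "valid (cur T) (free T) (history T)"
  using good_game[of T] by (simp add: good_def)

lemma game_Suc_cases:
  obtains (stay) "cur (Suc T) = cur T" "history (Suc T) = history T"
  | (break) s c ys where "cur T s \<noteq> []" "history (Suc T) = (c, cur T s) # history T" "cur (Suc T) = (cur T)(s := ys)"
proof (rule game_step_cases[of T "game m rej T"])
  assume "game_step m rej T (game m rej T) = game m rej T"
  then show ?thesis using stay by (simp add: game_Suc)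
next
  fix s c xs w
  assume "game_step m rej T (game m rej T) = break_tuple m (game m rej T) s c xs"
    "cur T s = xs" "xs \<noteq> []"
  then show ?thesis
    using break[of s c] by (simp add: game_Suc break_tuple_def Let_def current_Cons)
qed

section \<open>Stabilisation of the tuples\<close>

abbreviation "uses T s \<equiv> length (filter (\<lambda>e. snd e !. 0 = s) (history T))"

lemma uses_mono: "T \<le> T' \<Longrightarrow> uses T s \<le> uses T' s"
proof (induction rule: dec_induct)
  case (step T')
  then show ?case by (cases T' rule: game_Suc_cases) auto
qed simp

lemma cur_Suc_eq_or_uses:
  "cur (Suc T) s = cur T s \<or> uses (Suc T) s = Suc (uses T s)"
proof (cases T rule: game_Suc_cases)
  case (break s' c ys)
  then show ?thesis using validD(1)[OF valid_game, of T s'] by auto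
qed simp

text \<open>Each change at \<open>s\<close> adds a broken tuple with \<open>s\<close> in role 0, and
  \<open>cap\<close> bounds their number; a stage at which this number is maximal will do.\<close>

lemma cur_eventually_constant:
  "\<exists>T. (\<forall>T'\<ge>T. cur T' s = cur T s) \<and> (\<forall>T'. uses T' s \<le> uses T s)"
proof -
  have "\<forall>T. uses T s \<le> cap" using uses_le[OF valid_game, of 0] by blast
  then obtain T where T: "\<And>T'. uses T' s \<le> uses T s"
    using ex_has_greatest_nat[of "\<lambda>_. True" 0 "\<lambda>T. uses T s" "Suc cap"] by auto (metis le_imp_less_Suc)
  have "cur T' s = cur T s" if "T \<le> T'" for T'
    using that
  proof (induction rule: dec_induct)
    case (step T')
    then show ?case
      using cur_Suc_eq_or_uses[of T' s] T[of "Suc T'"] uses_mono[of T T' s] by auto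
  qed simp
  then show ?thesis using T by blast
qed

lemma final_tuple:
  obtains T where "cur T s = []" |
    T where "length (cur T s) = Suc m" "cur T s !. 0 = s"
      "\<And>i j w. i \<le> m \<Longrightarrow> j \<le> m \<Longrightarrow> i \<noteq> j \<Longrightarrow> \<not> rej w (cur T s !. i) (cur T s !. j)"
proof -
  obtain T where T: "\<And>T'. T \<le> T' \<Longrightarrow> cur T' s = cur T s" "\<And>T'. uses T' s \<le> uses T s"
    using cur_eventually_constant[of s] by blast
  show ?thesis
  proof (cases "cur T s = []")
    case True
    then show ?thesis using that(1) by blast
  next
    case False
    have "\<not> rej w (cur T s !. i) (cur T s !. j)" if ij: "i \<le> m" "j \<le> m" "i \<noteq> j" for i j w
    proof
      assume rej: "rej w (cur T s !. i) (cur T s !. j)"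
      \<comment> \<open>The stage that tests this very rejection; \<open>T\<close> in the dummy last
        component places it at or after stage \<open>T\<close>.\<close>
      define t where "t = prod_encode (s, prod_encode (i, prod_encode (j, prod_encode (w, T))))"
      have "T \<le> t" unfolding t_def by (meson le_prod_encode_2 order_trans)
      then have cur: "cur t s = cur T s" by (rule T(1))
      have "game m rej (Suc t) = break_tuple m (game m rej t) s (i, j) (cur t s)"
        unfolding game_Suc game_step_def Let_def using ij False rej cur by (simp add: t_def)
      then have "history (Suc t) = ((i, j), cur t s) # history t" by (simp add: break_tuple_def Let_def)
      then have "uses (Suc t) s = Suc (uses t s)" using validD(1)[OF valid_game, of t s] False cur by auto
      then show False using T(2)[of "Suc t"] uses_mono[OF \<open>T \<le> t\<close>, of s] by simp
    qed
    then show ?thesis using that(2)[of T] validD(1)[OF valid_game, of T s] False by blast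
  qed
qed

section \<open>Counting single strings and partners\<close>

definition bad :: "nat \<Rightarrow> bool" where
  "bad s \<longleftrightarrow> (\<exists>T. cur T s = [])"

definition partner :: "nat \<Rightarrow> nat \<Rightarrow> bool" where
  "partner y x \<longleftrightarrow> (\<exists>T s i j. i \<le> m \<and> j \<le> m \<and> cur T s \<noteq> [] \<and> cur T s !. i = y \<and> cur T s !. j = x)"

text \<open>The number of possible causes. With the further factor \<open>2 ^ n\<close> in
  \<open>cap\<close> it yields the exponent \<open>n * (m\<^sup>2 + m + 1)\<close>.\<close>

lemma card_offdiagonal: "card {(i, j). i \<le> m \<and> j \<le> m \<and> i \<noteq> j} = m * (m + 1)"
proof -
  have "{(i, j). i \<le> m \<and> j \<le> m \<and> i \<noteq> j} = {..m} \<times> {..m} - (\<lambda>i. (i, i)) ` {..m}" by auto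
  also have "card \<dots> = card ({..m} \<times> {..m}) - card ((\<lambda>i. (i, i)) ` {..m})"
    by (rule card_Diff_subset) auto
  also have "card ((\<lambda>i. (i, i)) ` {..m}) = Suc m" by (simp add: card_image inj_on_def)
  finally show ?thesis by simp
qed

lemma bad_stage_eq: "{s. cur T s = []} = {s. (0, s) \<in> free T}"
  using validD(2)[OF valid_game] by blast

lemma finite_bad_stage: "finite {s. cur T s = []}"
  unfolding bad_stage_eq by (rule finite_subset[of _ "snd ` free T"]) force+

lemma card_bad_stage: "card {s. cur T s = []} \<le> (2 ^ n) ^ (m * (m + 1)) * (m * cap)"
proof (rule card_le_mult_fibres)
  note V = valid_game[of T]
  let ?D = "{(i, j). i \<le> m \<and> j \<le> m \<and> i \<noteq> j}"
  \<comment> \<open>Levels restricted to possible causes; counting diagonal entries as well would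
    enlarge the exponent by a multiple of \<open>n\<close>.\<close>
  let ?f = "\<lambda>s. restrict (\<lambda>c. breaks (history T) c 0 s) ?D"
  have D: "finite ?D" by (rule finite_subset[of _ "{..m} \<times> {..m}"]) auto
  show "finite {s. cur T s = []}" by (rule finite_bad_stage)
  have "card (?f ` {s. cur T s = []}) \<le> card (?D \<rightarrow>\<^sub>E {..<(2::nat) ^ n})"
    using breaks_less[OF V, of _ _ 0] D by (intro card_mono finite_PiE image_subsetI restrict_PiE_iff[THEN iffD2]) auto
  also have "\<dots> = (2 ^ n) ^ (m * (m + 1))"
    using D by (simp add: card_PiE card_offdiagonal del: power_mult)
  finally show "card (?f ` {s. cur T s = []}) \<le> (2 ^ n) ^ (m * (m + 1))" .
  show "card {s \<in> {s. cur T s = []}. ?f s = v} \<le> m * cap" for v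
  proof (cases "\<exists>s. cur T s = [] \<and> ?f s = v")
    case True
    then obtain s where s: "cur T s = []" "?f s = v" by blast
    \<comment> \<open>Diagonal counts are 0, so the restricted counts determine the level.\<close>
    have "lev (history T) 0 s' = lev (history T) 0 s" if "?f s' = v" for s'
      unfolding level_eq_iff
    proof (intro allI impI)
      fix i j assume ij: "i \<le> m" "j \<le> m"
      show "breaks (history T) (i, j) 0 s' = breaks (history T) (i, j) 0 s"
      proof (cases "i = j")
        case True
        then have "breaks (history T) (i, j) 0 z = 0" for z
          unfolding breaks_def using validD(8)[OF V] by (force simp: filter_empty_conv)
        then show ?thesis by simp
      next
        case False
        have "?f s' (i, j) = ?f s (i, j)" using that s(2) by (simp only:)
        then show ?thesis using False ij by simp
      qed
    qed
    then have "{s' \<in> {s. cur T s = []}. ?f s' = v} \<subseteq> pool m (free T) (history T) 0 (lev (history T) 0 s)"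
      unfolding bad_stage_eq pool_def by blast
    then have "card {s' \<in> {s. cur T s = []}. ?f s' = v} \<le> card (pool m (free T) (history T) 0 (lev (history T) 0 s))"
      by (intro card_mono finite_pool) auto
    then show ?thesis using good_game[of T] unfolding good_def by (meson order_trans)
  next
    case False
    then have "{s \<in> {s. cur T s = []}. ?f s = v} = {}" by blast
    then show ?thesis by (simp only: card.empty le0)
  qed
qed

lemma finite_card_bad: "finite {s. bad s} \<and> card {s. bad s} \<le> (2 ^ n) ^ (m * (m + 1)) * (m * cap)"
proof -
  \<comment> \<open>Only a string that has a tuple can have it broken and regrouped, so a single
    string never gets a tuple in role 0 again.\<close>
  have mono: "{s. cur T s = []} \<subseteq> {s. cur T' s = []}" if "T \<le> T'" for T T'
    using that
  proof (induction rule: dec_induct)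
    case (step T')
    then show ?case by (cases T' rule: game_Suc_cases) auto
  qed simp
  have "finite (\<Union>T. {s. cur T s = []}) \<and>
      card (\<Union>T. {s. cur T s = []}) \<le> (2 ^ n) ^ (m * (m + 1)) * (m * cap)"
    by (intro card_UN_chain_le mono finite_bad_stage card_bad_stage)
  moreover have "(\<Union>T. {s. cur T s = []}) = {s. bad s}" by (auto simp: bad_def)
  ultimately show ?thesis by simp
qed

definition stage_partners :: "nat \<Rightarrow> nat \<Rightarrow> nat set" where
  "stage_partners T y = (\<Union>i\<le>m. \<Union>j\<le>m. {snd e !. j |e. e \<in> set (history T) \<and> snd e !. i = y} \<union>
    {cur T s !. j |s. cur T s \<noteq> [] \<and> cur T s !. i = y})"

lemma finite_card_stage_partners:
  "finite (stage_partners T y) \<and> card (stage_partners T y) \<le> (m + 1)\<^sup>2 * (cap + 1)"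
proof -
  note V = valid_game[of T]
  let ?L = "\<lambda>i j. {snd e !. j |e. e \<in> set (history T) \<and> snd e !. i = y}"
  let ?C = "\<lambda>i j. {cur T s !. j |s. cur T s \<noteq> [] \<and> cur T s !. i = y}"
  have L: "finite (?L i j)" for i j by (rule finite_partners)
  have C: "finite (?C i j) \<and> card (?C i j) \<le> 1" if "i \<le> m" for i j
  proof (cases "\<exists>s. cur T s \<noteq> [] \<and> cur T s !. i = y")
    case True
    then obtain s where s: "cur T s \<noteq> []" "cur T s !. i = y" by blast
    then have "?C i j \<subseteq> {cur T s !. j}" using validD(5)[OF V that] by blast
    then show ?thesis using card_mono[of "{cur T s !. j}"] finite_subset by fastforce
  next
    case False
    then have "?C i j = {}" by blast
    then show ?thesis by (simp only: card.empty finite.emptyI) simp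
  qed
  have fin: "finite (?L i j \<union> ?C i j)" if "i \<le> m" for i j
    using finite_UnI[OF L conjunct1[OF C[OF that]]] .
  \<comment> \<open>\<open>cap\<close> accounts for the broken tuples, 1 for the unbroken tuple with
    \<open>y\<close> in role \<open>i\<close>.\<close>
  have card: "card (?L i j \<union> ?C i j) \<le> cap + 1" if "i \<le> m" for i j
    using conjunct2[OF C[OF that, of j]] card_partners_le[OF V that, where q = j and x = y]
      card_Un_le[of "?L i j" "?C i j"] by linarith
  have "card (stage_partners T y) \<le> (\<Sum>i\<le>m. card (\<Union>j\<le>m. ?L i j \<union> ?C i j))"
    unfolding stage_partners_def by (rule card_UN_le) simp
  also have "\<dots> \<le> (\<Sum>i\<le>m. \<Sum>j\<le>m. card (?L i j \<union> ?C i j))"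
    by (intro sum_mono card_UN_le) simp
  also have "\<dots> \<le> (\<Sum>i\<le>m. \<Sum>j\<le>m. cap + 1)" by (intro sum_mono card) simp
  also have "\<dots> = (m + 1)\<^sup>2 * (cap + 1)" by (simp add: power2_eq_square algebra_simps)
  finally show ?thesis using fin unfolding stage_partners_def by auto
qed

text \<open>A tuple that ceases to be current enters the log, so no partner is lost.\<close>

lemma stage_partners_mono:
  assumes "T \<le> T'"
  shows "stage_partners T y \<subseteq> stage_partners T' y"
  using assms
proof (induction rule: dec_induct)
  case (step T')
  have "stage_partners T' y \<subseteq> stage_partners (Suc T') y"
  proof (cases T' rule: game_Suc_cases)
    case stay
    then show ?thesis by (simp add: stage_partners_def)
  next
    case (break s c ys)
    show ?thesis
    proof
      fix x assume "x \<in> stage_partners T' y"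
      then obtain i j where ij: "i \<le> m" "j \<le> m"
        and "(\<exists>e\<in>set (history T'). snd e !. i = y \<and> x = snd e !. j) \<or>
          (\<exists>s. cur T' s \<noteq> [] \<and> cur T' s !. i = y \<and> x = cur T' s !. j)"
        unfolding stage_partners_def by blast
      then have "(\<exists>e\<in>set (history (Suc T')). snd e !. i = y \<and> x = snd e !. j) \<or>
          (\<exists>s. cur (Suc T') s \<noteq> [] \<and> cur (Suc T') s !. i = y \<and> x = cur (Suc T') s !. j)"
        unfolding break(2,3) by (auto split: if_splits)
      then show "x \<in> stage_partners (Suc T') y" using ij unfolding stage_partners_def by blast
    qed
  qed
  then show ?case using step by blast
qed simp

lemma finite_card_partner:
  "finite {x. partner y x} \<and> card {x. partner y x} \<le> (m + 1)\<^sup>2 * (cap + 1)"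
proof -
  have U: "finite (\<Union>T. stage_partners T y) \<and> card (\<Union>T. stage_partners T y) \<le> (m + 1)\<^sup>2 * (cap + 1)"
    using finite_card_stage_partners by (intro card_UN_chain_le stage_partners_mono) blast+
  moreover have "{x. partner y x} \<subseteq> (\<Union>T. stage_partners T y)"
    unfolding partner_def stage_partners_def by blast
  ultimately show ?thesis by (meson card_mono finite_subset order_trans)
qed

end


section \<open>Computability of the game\<close>

text \<open>Here and below, bound variables in a definition turn the argument into a nested pair, so
  the assumptions are also supplied in composition with projections.\<close>

lemma computable_breaks:
  assumes "computable B" "computable c" "computable r" "computable x"
  shows "computable (\<lambda>e. breaks (B e) (c e) (r e) (x e))"
  unfolding breaks_def
  by (intro computable_intros assms(1) computable_compose[OF assms(2)]
      computable_compose[OF assms(3)] computable_compose[OF assms(4)])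

lemma computable_level:
  assumes "computable m" "computable B" "computable r" "computable x"
  shows "computable (\<lambda>e. level (m e) (B e) (r e) (x e))"
  unfolding level_def
  by (intro computable_intros computable_breaks assms(1) computable_compose[OF assms(1)]
      computable_compose[OF assms(2), where g = "\<lambda>p. fst (fst p)"]
      computable_compose[OF assms(3), where g = "\<lambda>p. fst (fst p)"]
      computable_compose[OF assms(4), where g = "\<lambda>p. fst (fst p)"])

lemma computable_current:
  assumes "computable m" "computable A" "computable s"
  shows "computable (\<lambda>e. current (m e) (A e) (s e))"
  unfolding current_def
  by (intro computable_intros assms computable_compose[OF assms(3)])

lemma computable_extend:
  assumes "computable m" "computable P" "computable B" "computable s" "computable ys"
  shows "computable (\<lambda>e. extend (m e) (P e) (B e) (s e) (ys e))"
  unfolding extend_def candidates_def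
  by (intro computable_intros computable_level assms(2,5) computable_compose[OF assms(1)]
      computable_compose[OF assms(3)] computable_compose[OF assms(4)] computable_compose[OF assms(5)]
      computable_compose[OF assms(5), where g = "\<lambda>p. fst (fst p)"]
      computable_compose[OF assms(5), where g = "\<lambda>p. fst (fst (fst p))"])

lemma computable_regroup:
  assumes "computable m" "computable P" "computable B" "computable s"
  shows "computable (\<lambda>e. regroup (m e) (P e) (B e) (s e))"
  unfolding regroup_def
  by (intro computable_intros computable_extend assms computable_compose[OF assms(1)]
      computable_compose[OF assms(2)] computable_compose[OF assms(3)] computable_compose[OF assms(4)])

lemma computable_released:
  assumes "computable m" "computable P" "computable xs"
  shows "computable (\<lambda>e. released (m e) (P e) (xs e))"
  unfolding released_def
  by (intro computable_intros assms(1,2) computable_compose[OF assms(3)])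

lemma computable_break_tuple:
  assumes "computable m" "computable st" "computable s" "computable c" "computable xs"
  shows "computable (\<lambda>e. break_tuple (m e) (st e) (s e) (c e) (xs e))"
  unfolding break_tuple_def Let_def
  by (intro computable_intros computable_regroup computable_released assms
      computable_compose[OF assms(1)] computable_compose[OF assms(2)] computable_compose[OF assms(3)]
      computable_compose[OF assms(4)] computable_compose[OF assms(5)])

lemma computable_game_step:
  assumes rej: "decidable (\<lambda>q. rej (fst q) (fst (snd q)) (fst (snd (snd q))) (snd (snd (snd q))))"
    and "computable m" "computable t" "computable st"
  shows "computable (\<lambda>e. game_step (m e) (rej e) (t e) (st e))"
proof -
  have rej': "decidable (\<lambda>e. rej e (w e) (a e) (b e))" if "computable w" "computable a" "computable b" for w a b
    using decidable_compose[OF rej, of "\<lambda>e. (e, w e, a e, b e)"] that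
    by (simp add: computable_intros)
  show ?thesis
    unfolding game_step_def Let_def
    by (intro computable_intros rej' computable_break_tuple computable_current assms)
qed

text \<open>Uniformity in \<open>e\<close>, from which \<open>m\<close> and the parameter
  \<open>n\<close> of the rejection test are later computed, makes the final constant
  absolute.\<close>

lemma computable_game:
  assumes rej: "decidable (\<lambda>q. rej (fst q) (fst (snd q)) (fst (snd (snd q))) (snd (snd (snd q))))"
    and m: "computable m" and T: "computable T"
  shows "computable (\<lambda>e. game (m e) (rej e) (T e))"
proof -
  have rej': "decidable (\<lambda>q. rej (fst (fst q)) (fst (snd q)) (fst (snd (snd q))) (snd (snd (snd q))))"
    using decidable_compose[OF rej, of "\<lambda>q. (fst (fst q), snd q)"] by (simp add: computable_intros)
  have "computable (\<lambda>e. rec_nat ([], [], []) (\<lambda>t st. game_step (m e) (rej e) t st) (T e))"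
    by (intro computable_rec_nat T computable_game_step[where rej = "\<lambda>e. rej (fst e)"] rej'
        computable_compose[OF m] computable_intros)
  then show ?thesis unfolding game_def .
qed


section \<open>Equidistant strings\<close>

text \<open>Applied to the length \<open>k\<close> of the string with code \<open>m\<close>; it
  rests on \<open>Suc m <= 2 * m\<close>.\<close>

lemma log_bound:
  fixes m k :: nat
  assumes "1 \<le> m" "2 ^ k \<le> Suc m"
  shows "real k \<le> 1 + log 2 (real m)"
proof -
  have "(2::real) ^ k \<le> real (Suc m)"
    using assms(2) by (metis of_nat_le_iff of_nat_numeral of_nat_power)
  also have "\<dots> \<le> 2 * real m" using assms(1) by simp
  finally have "log 2 (2 ^ k) \<le> log 2 (2 * real m)"
    using assms(1) by (subst log_le_cancel_iff) auto
  then show ?thesis using assms(1) by (simp add: log_mult)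
qed

theorem theorem5:
  fixes U :: "bool list \<Rightarrow> bool list \<Rightarrow> bool list option"
  assumes "optimal_language U"
  shows "\<exists>c::real. \<forall>(m::nat) (n::nat) (x\<^sub>0::bool list).
    m \<ge> 1 \<longrightarrow>
    ereal_of_enat (complexity U x\<^sub>0)
      > ereal (real n * (real m ^ 2 + real m + 1) + c * (1 + log 2 (real m))) \<longrightarrow>
    (\<exists>x :: nat \<Rightarrow> bool list. x 0 = x\<^sub>0 \<and>
      (\<forall>i\<in>{0..m}. \<forall>j\<in>{0..m}. i \<noteq> j \<longrightarrow>
        enat n \<le> cond_complexity U (x i) (x j) \<and>
        ereal_of_enat (cond_complexity U (x i) (x j))
          \<le> ereal (real n + c * (1 + log 2 (real m)))))"
proof -
  obtain f where f: "\<And>p y x. U p y = Some x \<longleftrightarrow> recf_eval f [string_code p, string_code y] (string_code x)"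
    using assms unfolding optimal_language_def programming_language_def by blast
  \<comment> \<open>\<open>Suc p < 2 ^ n\<close> says that the program with code \<open>p\<close> is
    shorter than \<open>n\<close>.\<close>
  define simple where "simple n a b \<longleftrightarrow> (\<exists>p. Suc p < 2 ^ n \<and> recf_eval f [p, b] a)" for n a b
  have "semidec (\<lambda>q. simple (fst q) (fst (snd q)) (snd (snd q)))"
    unfolding simple_def
    by (intro semidec_ex semidec_conj semidec_decidable
        semidec_compose[OF semidec_recf_eval, of "\<lambda>p. ([snd p, snd (snd (fst p))], fst (snd (fst p)))", simplified]
        computable_intros)
  then obtain S where S: "decidable S"
    and simple: "\<And>q. simple (fst q) (fst (snd q)) (snd (snd q)) \<longleftrightarrow> (\<exists>w::nat. S (w, q))"
    unfolding semidec_def by blast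
  define rej where "rej n w a b = S (w, n, a, b)" for n w a b
  have simple_rej: "(\<exists>w. rej n w a b) \<longleftrightarrow> simple n a b" for n a b
    using simple[of "(n, a, b)"] by (simp add: rej_def)
  have le_complexity: "enat n \<le> cond_complexity U x y"
    if "\<And>w. \<not> rej n w (string_code x) (string_code y)" for n x y
    unfolding cond_complexity_def
  proof (rule INF_greatest)
    fix p assume "p \<in> {p. U p y = Some x}"
    then have "\<not> Suc (string_code p) < 2 ^ n"
      using that simple_rej[of n "string_code x" "string_code y"] f[of p y x] unfolding simple_def by blast
    then show "enat n \<le> enat (length p)" by (simp flip: length_less_iff_string_code)
  qed
  have game: "matching_game n (rej n)" for n
  proof
    fix b
    \<comment> \<open>A program has at most one output on condition \<open>b\<close>, so the
      rejected strings are images of the \<open>2 ^ n - 1\<close> short programs.\<close>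
    let ?F = "\<lambda>p. THE a. recf_eval f [p, b] a"
    have sub: "{a. \<exists>w. rej n w a b} \<subseteq> ?F ` {..<2 ^ n - 1}"
    proof
      fix a assume "a \<in> {a. \<exists>w. rej n w a b}"
      then obtain p where p: "Suc p < 2 ^ n" "recf_eval f [p, b] a"
        using simple_rej unfolding simple_def by auto
      then have "?F p = a" using recf_eval_functional by blast
      then show "a \<in> ?F ` {..<2 ^ n - 1}" using p(1) by force
    qed
    then show "finite {a. \<exists>w. rej n w a b}" by (rule finite_subset) simp
    have "card {a. \<exists>w. rej n w a b} \<le> card (?F ` {..<2 ^ n - 1})" using sub by (intro card_mono) auto
    also have "\<dots> \<le> 2 ^ n - 1" using card_image_le[of "{..<2 ^ n - 1 :: nat}" ?F] by simp
    also have "\<dots> < 2 ^ n" by simp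
    finally show "card {a. \<exists>w. rej n w a b} < 2 ^ n" .
  qed
  let ?cur = "\<lambda>m n T. current m (fst (game m (rej n) T))"
  have computable_cur: "computable (\<lambda>e. ?cur (m e) (n e) (T e) (s e))"
    if "computable m" "computable n" "computable T" "computable s" for m n T s
    using that unfolding rej_def
    by (intro computable_current computable_game computable_intros decidable_compose[OF S]
        computable_compose[OF that(2)])
  \<comment> \<open>Only \<open>m\<close> and \<open>l\<close> are parameters: \<open>m\<close>
    determines \<open>k\<close>, and then \<open>l\<close> determines \<open>n\<close>. The summand
    \<open>4 * k + 5\<close> comes from \<open>(m + 1)\<^sup>2 <= 2 ^ (2 * k + 2)\<close> and
    \<open>cap + 1 <= 2 * 2 ^ (2 * k + 2) * 2 ^ n\<close>.\<close>
  define R where "R m l y x \<longleftrightarrow> (\<exists>n k T s i j. (l = n + (4 * k + 5) \<and> 2 ^ k \<le> Suc m \<and> Suc m < 2 * 2 ^ k) \<and>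
      i \<le> m \<and> j \<le> m \<and> ?cur m n T s \<noteq> [] \<and> ?cur m n T s !. i = y \<and> ?cur m n T s !. j = x)"
    for m l y x
  \<comment> \<open>In \<open>l\<close>, the levels contribute \<open>n * (m * m + m)\<close>, the
    factor \<open>m\<close> contributes \<open>k + 1\<close>, and \<open>cap\<close> contributes
    \<open>2 * k + 2 + n\<close>. Again \<open>n\<close> can be recovered from \<open>l\<close> and
    \<open>m\<close>.\<close>
  define Q where "Q m l y x \<longleftrightarrow> (\<exists>n k T. (l = n * (m * m + m + 1) + (3 * k + 3) \<and> 2 ^ k \<le> Suc m \<and> Suc m < 2 * 2 ^ k) \<and>
      ?cur m n T x = [])"
    for m l y x :: nat
  have "semidec (\<lambda>q. R (fst q) (fst (snd q)) (fst (snd (snd q))) (snd (snd (snd q))))"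
    unfolding R_def
    by (intro semidec_ex, rule semidec_decidable, intro computable_intros computable_cur)
  from complexity_le_of_enumeration[OF assms this]
  obtain c1 where c1: "\<And>a l y x. R (string_code a) l (string_code y) (string_code x) \<Longrightarrow>
    finite {z. R (string_code a) l (string_code y) z} \<Longrightarrow>
    card {z. R (string_code a) l (string_code y) z} \<le> 2 ^ l \<Longrightarrow>
    cond_complexity U x y \<le> enat (l + 2 * length a + c1)" by blast
  have "semidec (\<lambda>q. Q (fst q) (fst (snd q)) (fst (snd (snd q))) (snd (snd (snd q))))"
    unfolding Q_def
    by (intro semidec_ex, rule semidec_decidable, intro computable_intros computable_cur)
  from complexity_le_of_enumeration[OF assms this]
  obtain c2 where c2: "\<And>a l y x. Q (string_code a) l (string_code y) (string_code x) \<Longrightarrow>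
    finite {z. Q (string_code a) l (string_code y) z} \<Longrightarrow>
    card {z. Q (string_code a) l (string_code y) z} \<le> 2 ^ l \<Longrightarrow>
    cond_complexity U x y \<le> enat (l + 2 * length a + c2)" by blast
  \<comment> \<open>With \<open>2 * k\<close> bits for \<open>m\<close>, the overheads are
    \<open>6 * k + 5 + c1\<close> and \<open>5 * k + 3 + c2\<close>; since
    \<open>k <= 1 + log 2 m\<close>, both are at most \<open>c * (1 + log 2 m)\<close>.\<close>
  define c where "c = real (11 + c1 + c2)"
  show ?thesis
  proof (intro exI[of _ c] allI impI)
    fix m n x\<^sub>0
    assume m: "m \<ge> 1" and large: "ereal_of_enat (complexity U x\<^sub>0)
      > ereal (real n * (real m ^ 2 + real m + 1) + c * (1 + log 2 (real m)))"
    interpret matching_game m n "rej n" by (rule game)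
    obtain a where a: "string_code a = m" by (rule obtain_string)
    define k where "k = length a"
    \<comment> \<open>The inequalities in \<open>R\<close> and \<open>Q\<close> thus admit only
      \<open>k\<close>, the length of the string with code \<open>m\<close>.\<close>
    have k: "2 ^ j \<le> Suc m \<and> Suc m < 2 * 2 ^ j \<longleftrightarrow> j = k" for j
      using length_eq_iff_string_code[of a j] a by (auto simp: k_def)
    have k': "2 ^ k \<le> Suc m" "Suc m \<le> 2 ^ (k + 1)" using k[of k] by auto
    have logm: "real k \<le> 1 + log 2 (real m)" using log_bound[OF m k'(1)] .
    have square: "(m + 1)\<^sup>2 \<le> 2 ^ (2 * (k + 1))"
      using power_mono[OF k'(2), of 2] by (simp add: mult.commute flip: power_mult)
    then have cap: "cap \<le> 2 ^ (2 * (k + 1)) * 2 ^ n" unfolding cap_def by (rule mult_right_mono) simp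
    show "\<exists>x. x 0 = x\<^sub>0 \<and> (\<forall>i\<in>{0..m}. \<forall>j\<in>{0..m}. i \<noteq> j \<longrightarrow>
        enat n \<le> cond_complexity U (x i) (x j) \<and>
        ereal_of_enat (cond_complexity U (x i) (x j)) \<le> ereal (real n + c * (1 + log 2 (real m))))"
    proof (rule final_tuple[of "string_code x\<^sub>0"])
      \<comment> \<open>If \<open>x\<^sub>0\<close> ends up single, it lies in a small enumerable
        set, which contradicts \<open>large\<close>.\<close>
      fix T assume "cur T (string_code x\<^sub>0) = []"
      then have bad: "bad (string_code x\<^sub>0)" unfolding bad_def by blast
      define l where "l = n * (m * m + m + 1) + (3 * k + 3)"
      \<comment> \<open>The condition 0 is the code of the empty string, as plain complexity
        requires; \<open>n\<close> is recovered by cancelling the positive factor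
        \<open>m * m + m + 1\<close>.\<close>
      have Q: "Q m l 0 z \<longleftrightarrow> bad z" for z
        unfolding Q_def bad_def l_def using k by (auto simp del: mult_Suc_right)
      have "card {z. bad z} \<le> (2 ^ n) ^ (m * (m + 1)) * (m * cap)" using finite_card_bad by simp
      also have "\<dots> \<le> (2 ^ n) ^ (m * (m + 1)) * (2 ^ (k + 1) * (2 ^ (2 * (k + 1)) * 2 ^ n))"
        using k'(2) cap by (intro mult_le_mono) auto
      also have "\<dots> = 2 ^ l"
        unfolding l_def power_mult[symmetric] power_add[symmetric] power_Suc[symmetric]
        by (rule arg_cong[of _ _ "\<lambda>e. 2 ^ e"]) (simp add: algebra_simps)
      finally have "complexity U x\<^sub>0 \<le> enat (l + 2 * length a + c2)"
        unfolding complexity_def using c2[of a l "[]" x\<^sub>0] finite_card_bad bad by (simp add: Q a)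
      then have "ereal_of_enat (complexity U x\<^sub>0) \<le> ereal (real (l + 2 * length a + c2))"
        using ereal_of_enat_le_iff[of "complexity U x\<^sub>0" "enat (l + 2 * length a + c2)"] by simp
      also have "real (l + 2 * length a + c2) \<le>
          real n * (real m ^ 2 + real m + 1) + c * (1 + log 2 (real m))"
      proof -
        have "0 \<le> log 2 (real m)" using m by simp
        then have "0 \<le> real (6 + c1 + c2) * log 2 (real m)" by simp
        moreover have "real (l + 2 * length a + c2) = real n * (real m ^ 2 + real m + 1) + (5 * real k + 3 + real c2)"
          by (simp add: l_def k_def algebra_simps power2_eq_square)
        ultimately show ?thesis using logm by (simp add: c_def algebra_simps)
      qed
      finally show ?thesis using large by simp
    next
      fix T
      let ?s = "string_code x\<^sub>0"
      assume len: "length (cur T ?s) = Suc m" and s: "cur T ?s !. 0 = ?s"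
        and good: "\<And>i j w. i \<le> m \<Longrightarrow> j \<le> m \<Longrightarrow> i \<noteq> j \<Longrightarrow> \<not> rej n w (cur T ?s !. i) (cur T ?s !. j)"
      define x where "x i = inv string_code (cur T ?s !. i)" for i
      have x: "string_code (x i) = cur T ?s !. i" for i
        unfolding x_def by (rule surj_f_inv_f[OF surj_string_code])
      have "x 0 = x\<^sub>0" unfolding x_def s by (rule inv_f_f[OF inj_string_code])
      moreover have "enat n \<le> cond_complexity U (x i) (x j)" if "i \<le> m" "j \<le> m" "i \<noteq> j" for i j
        using good[OF that] by (intro le_complexity) (simp add: x)
      moreover have "ereal_of_enat (cond_complexity U (x i) (x j)) \<le> ereal (real n + c * (1 + log 2 (real m)))"
        if ij: "i \<le> m" "j \<le> m" for i j
      proof -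
        let ?l = "n + (4 * k + 5)"
        have R: "R m ?l y z \<longleftrightarrow> partner y z" for y z
          unfolding R_def partner_def using k by auto
        have partner: "partner (string_code (x j)) (string_code (x i))"
          unfolding partner_def x using ij len by (metis Zero_not_Suc list.size(3))
        have "card {z. partner (string_code (x j)) z} \<le> (m + 1)\<^sup>2 * (cap + 1)"
          using finite_card_partner by simp
        also have "\<dots> \<le> 2 ^ (2 * (k + 1)) * (2 * (2 ^ (2 * (k + 1)) * 2 ^ n))"
        proof (rule mult_le_mono)
          show "(m + 1)\<^sup>2 \<le> 2 ^ (2 * (k + 1))" by (rule square)
          have "1 \<le> (2::nat) ^ (2 * (k + 1)) * 2 ^ n" by simp
          then show "cap + 1 \<le> 2 * (2 ^ (2 * (k + 1)) * 2 ^ n)" using cap by linarith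
        qed
        also have "\<dots> = 2 ^ ?l"
        unfolding power_mult[symmetric] power_add[symmetric] power_Suc[symmetric]
        by (rule arg_cong[of _ _ "\<lambda>e. 2 ^ e"]) (simp add: algebra_simps)
        finally have "cond_complexity U (x i) (x j) \<le> enat (?l + 2 * length a + c1)"
          using c1[of a ?l "x j" "x i"] finite_card_partner partner by (simp add: R a)
        then have "ereal_of_enat (cond_complexity U (x i) (x j)) \<le> ereal (real (?l + 2 * length a + c1))"
          using ereal_of_enat_le_iff[of "cond_complexity U (x i) (x j)" "enat (?l + 2 * length a + c1)"] by simp
        also have "real (?l + 2 * length a + c1) \<le> real n + c * (1 + log 2 (real m))"
        proof -
          have "0 \<le> log 2 (real m)" using m by simp
          then have "0 \<le> real (5 + c1 + c2) * log 2 (real m)" by simp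
          moreover have "real (?l + 2 * length a + c1) = real n + (6 * real k + 5 + real c1)"
            by (simp add: k_def)
          ultimately show ?thesis using logm by (simp add: c_def algebra_simps)
        qed
        finally show ?thesis by simp
      qed
      ultimately show ?thesis by (intro exI[of _ x]) simp
    qed
  qed
qed

end
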